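(* Let $0<\beta\le 1$, $\alpha>0$, $\eta>0$, and for $t>0$, $x\in\mathbb{R}\setminus\{0\}$ let $$N(x,t)=\frac{t^{\beta-1}}{\alpha|x|}\,H^{2,1}_{3,3}\left[\frac{|x|}{(\eta t^{\beta})^{1/\alpha}}\,\middle|\,\begin{matrix}(1,1/\alpha),(\beta,\beta/\alpha),(1,1/2)\\(1,1),(1,1/\alpha),(1,1/2)\end{matrix}\right].$$ Then the fractional order moments $\langle|x|^{\delta}(t)\rangle=\int_{-\infty}^{\infty}|x|^{\delta}N(x,t)\,dx$ are given by $$\langle|x|^{\delta}(t)\rangle=\frac{2}{\alpha}\,\eta^{\delta/\alpha}\,t^{\beta\left\{(\delta/\alpha)+1-(1/\beta)\right\}}\;\frac{\Gamma\left(-\frac{\delta}{\alpha}\right)\Gamma(1+\delta)\,\Gamma\left(1+\frac{\delta}{\alpha}\right)}{\Gamma\left(-\frac{\delta}{2}\right)\Gamma\left(\beta+\frac{\beta\delta}{\alpha}\right)\Gamma\left(1+\frac{\delta}{2}\right)},$$ whenever the gamma functions exist, $\mathrm{Re}(\delta)>-1$ and $\mathrm{Re}(\delta+\alpha)>0$.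
   Context: The H-function is the Mellin-Barnes integral $$H^{m,n}_{p,q}\left[z\,\middle|\,\begin{matrix}(a_1,A_1),\dots,(a_p,A_p)\\(b_1,B_1),\dots,(b_q,B_q)\end{matrix}\right]=\frac{1}{2\pi i}\int_{\Omega}\theta(\xi)z^{-\xi}\,d\xi,\qquad \theta(\xi)=\frac{\prod_{j=1}^m\Gamma(b_j+B_j\xi)\prod_{j=1}^n\Gamma(1-a_j-A_j\xi)}{\prod_{j=m+1}^q\Gamma(1-b_j-B_j\xi)\prod_{j=n+1}^p\Gamma(a_j+A_j\xi)},$$ with $A_j,B_j>0$, empty products equal to $1$, no pole of any $\Gamma(b_j+B_j\xi)$ ($1\le j\le m$) coinciding with a pole of any $\Gamma(1-a_i-A_i\xi)$ ($1\le i\le n$), and $\Omega$ a contour separating these two sets of poles, being either a loop $L_{-\infty}$ beginning and ending at $-\infty$ in a horizontal strip, a loop $L_{+\infty}$ beginning and ending at $+\infty$ in a horizontal strip, or a contour $L_{i\gamma\infty}$ from $\gamma-i\infty$ to $\gamma+i\infty$.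
   Formalization: The formula is proved for every δ in the stated range for which the moment integral converges absolutely, and convergence is proved for Re(δ) < α; without this the claim fails (α = β = 1, δ = 3/2: Cauchy density, divergent moment). *)

theory Defs
  imports "HOL-Analysis.Analysis"
begin

section \<open>The Fox H-function\<close>

text \<open>
  The parameter rows \<open>(a\<^sub>1,A\<^sub>1),\<dots>,(a\<^sub>p,A\<^sub>p)\<close> and \<open>(b\<^sub>1,B\<^sub>1),\<dots>,(b\<^sub>q,B\<^sub>q)\<close> are lists, so that \<open>p\<close> and
  \<open>q\<close> are their lengths and the index \<open>j\<close> starts at 0.
\<close>

type_synonym fox_row = "(complex \<times> real) list"

text \<open>
  \<^const>\<open>Gamma\<close> is \<open>0\<close> at its poles and division by \<open>0\<close> yields \<open>0\<close>, so at a pole of a denominator factor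
  the quotient is \<open>0\<close>, in accordance with \<open>1/\<Gamma>\<close> being entire.
\<close>

definition fox_theta :: "nat \<Rightarrow> nat \<Rightarrow> fox_row \<Rightarrow> fox_row \<Rightarrow> complex \<Rightarrow> complex" where
  "fox_theta m n as bs \<xi> =
     ((\<Prod>j=0..<m. Gamma (fst (bs ! j) + of_real (snd (bs ! j)) * \<xi>)) *
      (\<Prod>j=0..<n. Gamma (1 - fst (as ! j) - of_real (snd (as ! j)) * \<xi>))) /
     ((\<Prod>j=m..<length bs. Gamma (1 - fst (bs ! j) - of_real (snd (bs ! j)) * \<xi>)) *
      (\<Prod>j=n..<length as. Gamma (fst (as ! j) + of_real (snd (as ! j)) * \<xi>)))"

definition fox_left_poles :: "nat \<Rightarrow> fox_row \<Rightarrow> complex set" where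
  "fox_left_poles m bs =
     {\<xi>. \<exists>j<m. fst (bs ! j) + of_real (snd (bs ! j)) * \<xi> \<in> \<int>\<^sub>\<le>\<^sub>0}"

definition fox_right_poles :: "nat \<Rightarrow> fox_row \<Rightarrow> complex set" where
  "fox_right_poles n as =
     {\<xi>. \<exists>j<n. 1 - fst (as ! j) - of_real (snd (as ! j)) * \<xi> \<in> \<int>\<^sub>\<le>\<^sub>0}"

definition fox_params :: "nat \<Rightarrow> nat \<Rightarrow> fox_row \<Rightarrow> fox_row \<Rightarrow> bool" where
  "fox_params m n as bs \<longleftrightarrow>
     m \<le> length bs \<and> n \<le> length as \<and>
     (\<forall>(a, A) \<in> set as. A > 0) \<and> (\<forall>(b, B) \<in> set bs. B > 0) \<and>
     fox_left_poles m bs \<inter> fox_right_poles n as = {}"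

text \<open>
  Contours are simple, piecewise continuously differentiable curves parametrised by the whole real
  line.  As usual they are taken to coincide with straight rays near their two ends, so that only a
  compact part may be indented.  The loops are oriented by \<open>\<phi>1 < \<phi>2\<close>; the left loop thus encircles the
  left poles counterclockwise, and the right loop encircles the right poles clockwise.
\<close>

definition simple_contour :: "(real \<Rightarrow> complex) \<Rightarrow> bool" where
  "simple_contour \<Omega> \<longleftrightarrow> \<Omega> piecewise_C1_differentiable_on UNIV \<and> inj \<Omega>"

definition L_vertical :: "(real \<Rightarrow> complex) \<Rightarrow> bool" where
  "L_vertical \<Omega> \<longleftrightarrow> simple_contour \<Omega> \<and>
     (\<exists>\<gamma>. (\<forall>\<^sub>F t in at_bot. Re (\<Omega> t) = \<gamma>) \<and> (\<forall>\<^sub>F t in at_top. Re (\<Omega> t) = \<gamma>)) \<and>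
     filterlim (\<lambda>t. Im (\<Omega> t)) at_bot at_bot \<and> filterlim (\<lambda>t. Im (\<Omega> t)) at_top at_top"

definition L_left_loop :: "(real \<Rightarrow> complex) \<Rightarrow> bool" where
  "L_left_loop \<Omega> \<longleftrightarrow> simple_contour \<Omega> \<and>
     (\<exists>\<phi>1 \<phi>2. \<phi>1 < \<phi>2 \<and>
        (\<forall>\<^sub>F t in at_bot. Im (\<Omega> t) = \<phi>1) \<and> (\<forall>\<^sub>F t in at_top. Im (\<Omega> t) = \<phi>2)) \<and>
     filterlim (\<lambda>t. Re (\<Omega> t)) at_bot at_bot \<and> filterlim (\<lambda>t. Re (\<Omega> t)) at_bot at_top"

definition L_right_loop :: "(real \<Rightarrow> complex) \<Rightarrow> bool" where
  "L_right_loop \<Omega> \<longleftrightarrow> simple_contour \<Omega> \<and>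
     (\<exists>\<phi>1 \<phi>2. \<phi>1 < \<phi>2 \<and>
        (\<forall>\<^sub>F t in at_bot. Im (\<Omega> t) = \<phi>1) \<and> (\<forall>\<^sub>F t in at_top. Im (\<Omega> t) = \<phi>2)) \<and>
     filterlim (\<lambda>t. Re (\<Omega> t)) at_top at_bot \<and> filterlim (\<lambda>t. Re (\<Omega> t)) at_top at_top"

definition separates :: "(real \<Rightarrow> complex) \<Rightarrow> complex set \<Rightarrow> complex set \<Rightarrow> bool" where
  "separates \<Omega> P Q \<longleftrightarrow>
     (\<exists>U \<in> components (- range \<Omega>). \<exists>V \<in> components (- range \<Omega>). U \<noteq> V \<and> P \<subseteq> U \<and> Q \<subseteq> V)"

text \<open>
  \<open>fox_H_along C m n as bs z v\<close>: the Mellin-Barnes integral along some separating contour of kind \<open>C\<close>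
  converges, with value \<open>v\<close>.  The gauge integral over the parameter line covers both absolutely and
  conditionally convergent contour integrals.
\<close>

definition fox_H_along ::
  "((real \<Rightarrow> complex) \<Rightarrow> bool) \<Rightarrow> nat \<Rightarrow> nat \<Rightarrow> fox_row \<Rightarrow> fox_row \<Rightarrow> complex \<Rightarrow> complex \<Rightarrow> bool" where
  "fox_H_along C m n as bs z v \<longleftrightarrow>
     fox_params m n as bs \<and>
     (\<exists>\<Omega> I. C \<Omega> \<and> separates \<Omega> (fox_left_poles m bs) (fox_right_poles n as) \<and>
        ((\<lambda>t. fox_theta m n as bs (\<Omega> t) * z powr (- \<Omega> t) * vector_derivative \<Omega> (at t))
           has_integral I) UNIV \<and>
        v = 1 / (2 * of_real pi * \<i>) * I)"

text \<open>
  The integral need not converge along all three kinds of contour; where several kinds are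
  available they give the same value.  The vertical contour is used whenever it is available.
\<close>

definition fox_H :: "nat \<Rightarrow> nat \<Rightarrow> fox_row \<Rightarrow> fox_row \<Rightarrow> complex \<Rightarrow> complex" where
  "fox_H m n as bs z =
     (if \<exists>v. fox_H_along L_vertical m n as bs z v
        then (THE v. fox_H_along L_vertical m n as bs z v)
      else if \<exists>v. fox_H_along L_left_loop m n as bs z v
        then (THE v. fox_H_along L_left_loop m n as bs z v)
      else (THE v. fox_H_along L_right_loop m n as bs z v))"


section \<open>The density and its fractional moments\<close>

text \<open>Only \<open>x \<noteq> 0\<close> and \<open>t > 0\<close> are meaningful.\<close>

definition diffusion_N :: "real \<Rightarrow> real \<Rightarrow> real \<Rightarrow> real \<Rightarrow> real \<Rightarrow> complex" where
  "diffusion_N \<alpha> \<beta> \<eta> x t =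
     of_real (t powr (\<beta> - 1) / (\<alpha> * \<bar>x\<bar>)) *
     fox_H 2 1
       [(1, 1 / \<alpha>), (of_real \<beta>, \<beta> / \<alpha>), (1, 1 / 2)]
       [(1, 1), (1, 1 / \<alpha>), (1, 1 / 2)]
       (of_real (\<bar>x\<bar> / (\<eta> * t powr \<beta>) powr (1 / \<alpha>)))"

definition moment_integrand :: "real \<Rightarrow> real \<Rightarrow> real \<Rightarrow> complex \<Rightarrow> real \<Rightarrow> real \<Rightarrow> complex" where
  "moment_integrand \<alpha> \<beta> \<eta> \<delta> t x = of_real \<bar>x\<bar> powr \<delta> * diffusion_N \<alpha> \<beta> \<eta> x t"

definition fractional_moment :: "real \<Rightarrow> real \<Rightarrow> real \<Rightarrow> complex \<Rightarrow> real \<Rightarrow> complex" where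
  "fractional_moment \<alpha> \<beta> \<eta> \<delta> t = (LINT x|lborel. moment_integrand \<alpha> \<beta> \<eta> \<delta> t x)"

end

theory Submission
  imports Defs "HOL-Complex_Analysis.Complex_Analysis" "HOL-Probability.Sinc_Integral"
begin

text \<open>
  By the reflection formula the Mellin-Barnes kernel is
  \<open>\<theta>(\<xi>) = sin (\<pi>\<xi>/2) / sin (\<pi>\<xi>/\<alpha>) * \<Gamma>(1 + \<xi>) / \<Gamma>(\<beta> + \<beta>\<xi>/\<alpha>)\<close>, so that it decays exponentially in vertical
  strips, at the rate \<open>\<pi>(2 - \<beta>)/(2\<alpha>)\<close>, and its singularity at \<open>0\<close> is removable.  Hence \<open>H\<close> is an inverse
  Mellin transform along any vertical line in the strip \<open>- min 1 \<alpha> < Re \<xi> < \<alpha>\<close>, and the moment is the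
  Mellin transform of \<open>H\<close>: integrate over \<open>(0,1)\<close> with a line to the left of \<open>\<delta>\<close> and over \<open>(1,\<infinity>)\<close> with
  one to the right of \<open>\<delta>\<close>; by Cauchy's formula the two contributions add up to \<open>\<theta>(\<delta>)\<close>.

  If \<open>Re \<delta> \<ge> \<alpha>\<close> and the integrand is integrable, then \<open>\<theta>\<close> stays bounded as \<open>\<xi> \<rightarrow> \<alpha>\<close> from the left, which
  forces the pole at \<open>\<alpha>\<close> to be absent, that is, \<open>\<alpha>\<close> to be an even integer.  In that case the quotient of
  sines is entire and the strip extends to the whole half-plane \<open>Re \<xi> > - 1\<close>.
\<close>

section \<open>Growth of the gamma function in vertical strips\<close>

text \<open>Three obstacles shape the proof. \<open>fox_H\<close> selects its value by a definite
  description over all separating contours of vertical kind, indented ones and merely conditionally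
  convergent integrals included. So it has no usable value until every such contour is known to give
  the same integral; this is what the winding numbers are for. Separation refers to the poles of the
  single gamma factors. Thus 0 is a right pole, though a zero of 1/\<Gamma>(-\<xi>/2) cancels it,
  and a straight contour must lie strictly left of 0. The wider strip of Mellin inversion is
  available only after \<theta> has been replaced by a function that is regular at 0. No power of z
  is integrable on the whole half-line, so Fubini's theorem cannot be applied to the double integral
  over (0,\<infinity>) along one line; hence the cut at z = 1. The growth estimates rest on upper
  bounds for the entire function 1/\<Gamma> alone: reflection turns them into upper bounds for
  \<Gamma>. Exponential decay is weakened to 1/(1 + y^2), which is enough for integrability and for
  discarding the horizontal sides of rectangles.\<close>

text \<open>Each factor \<open>\<bar>x + k + i y\<bar> / (x + k)\<close> of the product formula for \<open>1/\<Gamma>\<close> is decreasing in \<open>x\<close>.\<close>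

lemma norm_rGamma_le:
  fixes x y :: real
  assumes "x \<ge> 1"
  shows "norm (rGamma (Complex x y)) \<le> rGamma x * norm (rGamma (Complex 1 y))"
proof -
  have factor: "norm (Complex x y + of_nat k) * (1 + real k) \<le> (x + real k) * norm (Complex 1 y + of_nat k)" for k
  proof -
    have "(x + real k)\<^sup>2 * (1 + real k)\<^sup>2 + y\<^sup>2 * (1 + real k)\<^sup>2
       \<le> (x + real k)\<^sup>2 * (1 + real k)\<^sup>2 + y\<^sup>2 * (x + real k)\<^sup>2"
      using assms by (intro add_left_mono mult_left_mono power_mono) auto
    then have "(norm (Complex x y + of_nat k) * (1 + real k))\<^sup>2 \<le> ((x + real k) * norm (Complex 1 y + of_nat k))\<^sup>2"
      by (simp add: power_mult_distrib cmod_power2) (simp add: algebra_simps)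
    then show ?thesis
      using assms by (auto intro!: power2_le_imp_le)
  qed
  have "norm (rGamma_series (Complex x y) n) * rGamma_series 1 n
      \<le> rGamma_series x n * norm (rGamma_series (Complex 1 y) n)" for n
  proof -
    \<comment> \<open>The factor n^z has modulus n^(Re z), so it is the same in the complex and the
      real series of equal abscissa and drops out of the comparison.\<close>
    have nrm: "norm (exp (Complex u y * of_real (ln (real n)))) = exp (u * ln (real n))" for u
      by simp
    have "(\<Prod>k=0..n. norm (Complex x y + of_nat k) * (1 + real k))
        \<le> (\<Prod>k=0..n. (x + real k) * norm (Complex 1 y + of_nat k))"
      using factor by (intro prod_mono) auto
    then have "norm (pochhammer (Complex x y) (n+1)) * pochhammer 1 (n+1)
        \<le> pochhammer x (n+1) * norm (pochhammer (Complex 1 y) (n+1))"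
      by (simp add: pochhammer_prod prod.distrib prod_norm atLeast0LessThan atLeast0AtMost lessThan_Suc_atMost)
    then show ?thesis
      unfolding rGamma_series_def norm_divide norm_mult nrm
      by (auto simp: divide_simps mult_ac intro!: mult_right_mono)
  qed
  then have "norm (rGamma (Complex x y)) * rGamma (1::real) \<le> rGamma x * norm (rGamma (Complex 1 y))"
    by (intro LIMSEQ_le[OF tendsto_mult[OF tendsto_norm[OF rGamma_series_LIMSEQ] rGamma_series_LIMSEQ]
          tendsto_mult[OF rGamma_series_LIMSEQ tendsto_norm[OF rGamma_series_LIMSEQ]]]) auto
  then show ?thesis
    by simp
qed

text \<open>Since 1/\<Gamma>(1 - iy) is the conjugate of 1/\<Gamma>(1 + iy), reflection evaluates
  the square of the modulus exactly as sinh(\<pi>y)/(\<pi>y). The bound then follows from sinh u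
  \<le> u e^u, a consequence of 1 - 2u \<le> e^(-2u).\<close>

lemma norm_rGamma_one_le: "norm (rGamma (Complex 1 y)) \<le> exp (pi * \<bar>y\<bar> / 2)"
proof (cases "y = 0")
  case True
  then show ?thesis by (simp add: complex_of_real_def[symmetric] flip: one_complex.code)
next
  case False
  have "rGamma (Complex 1 y) * rGamma (Complex 1 (-y)) = sin (of_real pi * (\<i> * of_real y)) / (of_real pi * (\<i> * of_real y))"
  proof -
    have 1: "Complex 1 y = 1 + \<i> * of_real y" "Complex 1 (-y) = 1 - \<i> * of_real y"
      by (auto simp: complex_eq_iff)
    have "rGamma (\<i> * of_real y) * rGamma (1 - \<i> * of_real y) = sin (of_real pi * (\<i> * of_real y)) / of_real pi"
      by (rule rGamma_reflection_complex)
    moreover have "rGamma (\<i> * of_real y) = (\<i> * of_real y) * rGamma (Complex 1 y)"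
      using rGamma_plus1[of "\<i> * of_real y"] by (simp add: 1 add_ac)
    ultimately show ?thesis using False unfolding 1 by (simp add: divide_simps mult_ac)
  qed
  moreover have "rGamma (Complex 1 (-y)) = cnj (rGamma (Complex 1 y))"
    by (simp add: cnj_rGamma complex_cnj)
  ultimately have prod: "rGamma (Complex 1 y) * cnj (rGamma (Complex 1 y)) = sin (of_real pi * (\<i> * of_real y)) / (of_real pi * (\<i> * of_real y))"
    by simp
  have "norm (rGamma (Complex 1 y)) ^ 2 = norm (rGamma (Complex 1 y) * cnj (rGamma (Complex 1 y)))"
    by (simp add: norm_mult power2_eq_square)
  also have "\<dots> = norm (sin (of_real pi * (\<i> * of_real y))) / (pi * \<bar>y\<bar>)"
    unfolding prod by (simp add: norm_mult norm_divide abs_mult)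
  also have "norm (sin (of_real pi * (\<i> * of_real y))) = \<bar>sinh (pi * y)\<bar>"
  proof -
    have "sin (of_real pi * (\<i> * of_real y)) = \<i> * of_real (sinh (pi * y))"
      by (simp add: sin_exp_eq sinh_def scaleR_conv_of_real exp_minus field_simps flip: exp_of_real)
    then show ?thesis by (simp add: norm_mult)
  qed
  also have "\<bar>sinh (pi * y)\<bar> = sinh (pi * \<bar>y\<bar>)"
    by (cases "y \<ge> 0") (auto simp: sinh_real_nonneg_iff sinh_real_nonpos_iff mult_le_0_iff zero_le_mult_iff)
  also have "sinh (pi * \<bar>y\<bar>) / (pi * \<bar>y\<bar>) \<le> exp (pi * \<bar>y\<bar>)"
  proof -
    define u where "u = pi * \<bar>y\<bar>"
    have u: "u > 0" using False by (simp add: u_def)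
    have "1 - 2 * u \<le> exp (-(2*u))" using exp_ge_add_one_self[of "-(2*u)"] by simp
    then have "exp u * (1 - 2 * u) \<le> exp u * exp (-(2*u))" by (intro mult_left_mono) auto
    also have "\<dots> = exp (-u)" by (simp flip: exp_add)
    finally have "sinh u \<le> u * exp u" by (simp add: sinh_def algebra_simps)
    then show ?thesis using u unfolding u_def by (simp add: divide_simps mult_ac)
  qed
  also have "exp (pi * \<bar>y\<bar>) = exp (pi * \<bar>y\<bar> / 2) ^ 2"
    by (simp flip: exp_of_nat_mult)
  finally show ?thesis by (rule power2_le_imp_le) auto
qed

text \<open>The recurrence moves the argument to Re \<ge> 1 at the price of a Pochhammer factor of
  degree n, which grows only polynomially in y. There the comparison with the line Re = 1 applies,
  and its real factor is bounded by compactness.\<close>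

lemma norm_rGamma_strip_bound:
  fixes A B :: real
  shows "\<exists>C\<ge>0. \<exists>N. \<forall>x y. A \<le> x \<and> x \<le> B \<longrightarrow>
           norm (rGamma (Complex x y)) \<le> C * (1 + \<bar>y\<bar>) ^ N * exp (pi * \<bar>y\<bar> / 2)"
proof -
  obtain n :: nat where n: "1 - A \<le> real n" using real_arch_simple by blast
  have "compact ((rGamma :: real \<Rightarrow> real) ` {1..B + real n})"
    by (intro compact_continuous_image continuous_intros compact_Icc)
  then obtain D where D': "\<forall>r \<in> rGamma ` {1..B + real n}. norm r \<le> D"
    using bounded_iff compact_imp_bounded by blast
  define D0 where "D0 = max D 0"
  have D: "D0 \<ge> 0" "\<And>x. 1 \<le> x \<Longrightarrow> x \<le> B + real n \<Longrightarrow> rGamma x \<le> D0"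
    using D' by (force simp: D0_def)+
  define K where "K = 1 + \<bar>A\<bar> + \<bar>B\<bar> + real n"
  show ?thesis
  proof (intro exI[of _ "K ^ n * D0"] exI[of _ n] conjI allI impI)
    fix x y :: real assume x: "A \<le> x \<and> x \<le> B"
    have "norm (pochhammer (Complex x y) n) \<le> (K * (1 + \<bar>y\<bar>)) ^ n"
    proof -
      have "norm (Complex x y + of_nat k) \<le> K * (1 + \<bar>y\<bar>)" if "k < n" for k
      proof -
        have "norm (Complex x y + of_nat k) \<le> \<bar>x + real k\<bar> + \<bar>y\<bar>"
          using cmod_le[of "Complex x y + of_nat k"] by simp
        also have "\<dots> \<le> K + \<bar>y\<bar>" using x that by (auto simp: K_def)
        also have "\<dots> \<le> K * (1 + \<bar>y\<bar>)"
        proof -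
          have "1 * \<bar>y\<bar> \<le> K * \<bar>y\<bar>" by (intro mult_right_mono) (auto simp: K_def)
          then show ?thesis by (simp add: algebra_simps)
        qed
        finally show ?thesis .
      qed
      then have "(\<Prod>k<n. norm (Complex x y + of_nat k)) \<le> (\<Prod>k<n. K * (1 + \<bar>y\<bar>))"
        by (intro prod_mono) auto
      then show ?thesis by (simp add: pochhammer_prod prod_norm atLeast0LessThan)
    qed
    moreover have "norm (rGamma (Complex (x + real n) y)) \<le> D0 * exp (pi * \<bar>y\<bar> / 2)"
    proof -
      have "norm (rGamma (Complex (x + real n) y)) \<le> rGamma (x + real n) * norm (rGamma (Complex 1 y))"
        using x n by (intro norm_rGamma_le) auto
      also have "\<dots> \<le> D0 * exp (pi * \<bar>y\<bar> / 2)"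
        using x n D by (intro mult_mono norm_rGamma_one_le) auto
      finally show ?thesis .
    qed
    moreover have "rGamma (Complex x y) = pochhammer (Complex x y) n * rGamma (Complex (x + real n) y)"
      using pochhammer_rGamma[of "Complex x y" n] by (simp add: Complex_eq add_ac)
    ultimately have "norm (rGamma (Complex x y)) \<le> (K * (1 + \<bar>y\<bar>)) ^ n * (D0 * exp (pi * \<bar>y\<bar> / 2))"
      by (auto simp: norm_mult K_def intro!: mult_mono)
    then show "norm (rGamma (Complex x y)) \<le> K ^ n * D0 * (1 + \<bar>y\<bar>) ^ n * exp (pi * \<bar>y\<bar> / 2)"
      by (simp add: power_mult_distrib mult_ac)
  qed (use D in \<open>auto simp: K_def\<close>)
qed

section \<open>Exponential bounds for the complex sine\<close>

lemma norm_sin_complex_le: "norm (sin z) \<le> exp \<bar>Im z\<bar>" for z :: complex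
proof -
  have "2 * norm (sin z) = norm (exp (\<i> * z) - exp (- (\<i> * z)))"
    unfolding sin_exp_eq by (simp add: norm_divide norm_mult)
  also have "\<dots> \<le> norm (exp (\<i> * z)) + norm (exp (- (\<i> * z)))"
    by (rule norm_triangle_ineq4)
  also have "\<dots> \<le> 2 * exp \<bar>Im z\<bar>" by (cases "Im z \<ge> 0") auto
  finally show ?thesis by simp
qed

text \<open>The modulus of sin z is at least sinh of \<bar>Im z\<bar>. At distance r from the real
  axis the decaying exponential is at most the fraction e^(-2r) of the growing one, which gives the
  constant.\<close>

lemma norm_sin_complex_ge:
  fixes z :: complex
  assumes "\<bar>Im z\<bar> \<ge> r" "r > 0"
  shows "norm (sin z) \<ge> (1 - exp (-2 * r)) / 2 * exp \<bar>Im z\<bar>"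
proof -
  have "exp \<bar>Im z\<bar> - exp (-\<bar>Im z\<bar>) \<le> norm (exp (\<i> * z) - exp (- (\<i> * z)))"
    using norm_triangle_ineq2[of "exp (\<i> * z)" "exp (- (\<i> * z))"]
       norm_triangle_ineq2[of "exp (- (\<i> * z))" "exp (\<i> * z)"]
    by (cases "Im z \<ge> 0") (auto simp: norm_minus_commute)
  also have "\<dots> = 2 * norm (sin z)"
    unfolding sin_exp_eq by (simp add: norm_divide norm_mult)
  finally have 1: "exp \<bar>Im z\<bar> - exp (-\<bar>Im z\<bar>) \<le> 2 * norm (sin z)" .
  have "exp (-\<bar>Im z\<bar>) = exp (-2 * \<bar>Im z\<bar>) * exp \<bar>Im z\<bar>" by (simp flip: exp_add)
  also have "\<dots> \<le> exp (-2 * r) * exp \<bar>Im z\<bar>" using assms by (intro mult_right_mono) auto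
  finally show ?thesis using 1 by (simp add: algebra_simps)
qed

section \<open>The Mellin-Barnes kernel\<close>

lemma poly_exp_bound:
  fixes k :: real
  assumes "k > 0"
  shows "\<exists>K\<ge>0. \<forall>t\<ge>0. (1 + t) ^ M * exp (- (k * t)) \<le> K"
proof (cases "M = 0")
  case True
  then show ?thesis using assms by (auto intro!: exI[of _ 1])
next
  case False
  \<comment> \<open>From (x/M)^M \<le> (1 + x/M)^M \<le> e^x with x = k(1 + t); the factor e^k is
    what remains of e^x after multiplication by e^(-kt).\<close>
  have "(1 + t) ^ M * exp (- (k * t)) \<le> (real M / k) ^ M * exp k" if "t \<ge> 0" for t
  proof -
    have "(k * (1 + t) / real M) ^ M \<le> (1 + k * (1 + t) / real M) ^ M"
      using that assms by (intro power_mono) auto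
    also have "\<dots> \<le> exp (k * (1 + t))"
    proof (intro exp_ge_one_plus_x_over_n_power_n)
      have "0 \<le> k * (1 + t)" using that assms by simp
      then show "- real M \<le> k * (1 + t)" by (meson neg_le_0_iff_le of_nat_0_le_iff order_trans)
    qed (use False in auto)
    finally have le: "(k * (1 + t) / real M) ^ M \<le> exp (k * (1 + t))" .
    have "(real M / k) * (k * (1 + t) / real M) = 1 + t" using assms False by simp
    then have "(1 + t) ^ M = (real M / k) ^ M * (k * (1 + t) / real M) ^ M"
      by (metis power_mult_distrib)
    then have "(1 + t) ^ M \<le> (real M / k) ^ M * exp (k * (1 + t))"
      using le assms by (simp only:) (intro mult_left_mono, auto)
    then have "(1 + t) ^ M * exp (- (k * t)) \<le> (real M / k) ^ M * exp (k * (1 + t)) * exp (- (k * t))"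
      by (intro mult_right_mono) auto
    also have "\<dots> = (real M / k) ^ M * exp k"
      by (simp add: algebra_simps flip: exp_add)
    finally show ?thesis .
  qed
  then show ?thesis using assms by (intro exI[of _ "(real M / k) ^ M * exp k"]) auto
qed

section \<open>The kernel and its form as a quotient of sines\<close>

abbreviation diffusion_as :: "real \<Rightarrow> real \<Rightarrow> fox_row" where
  "diffusion_as \<alpha> \<beta> \<equiv> [(1, 1 / \<alpha>), (of_real \<beta>, \<beta> / \<alpha>), (1, 1 / 2)]"

abbreviation diffusion_bs :: "real \<Rightarrow> fox_row" where
  "diffusion_bs \<alpha> \<equiv> [(1, 1), (1, 1 / \<alpha>), (1, 1 / 2)]"

abbreviation diffusion_theta :: "real \<Rightarrow> real \<Rightarrow> complex \<Rightarrow> complex" where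
  "diffusion_theta \<alpha> \<beta> \<equiv> fox_theta 2 1 (diffusion_as \<alpha> \<beta>) (diffusion_bs \<alpha>)"

text \<open>Written with \<open>rGamma\<close>, the denominator becomes a product of entire
  functions, so only the three \<open>Gamma\<close> factors restrict the domain. The identity holds
  at every point because the conventions for \<open>Gamma\<close> at its poles and for division by 0
  match the zeros of \<open>rGamma\<close>.\<close>

lemma diffusion_theta_eq:
  "diffusion_theta \<alpha> \<beta> s =
     Gamma (1 + s) * Gamma (1 + s / of_real \<alpha>) * Gamma (- (s / of_real \<alpha>)) *
     rGamma (- (s / 2)) * rGamma (of_real \<beta> + of_real \<beta> * s / of_real \<alpha>) * rGamma (1 + s / 2)"
proof -
  have sets: "{0..<2} = {0, 1::nat}" "{0..<1} = {0::nat}" "{2..<3} = {2::nat}" "{1..<3} = {1, 2::nat}"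
    by auto
  have lens: "length (diffusion_as \<alpha> \<beta>) = 3" "length (diffusion_bs \<alpha>) = 3" by simp_all
  have "diffusion_theta \<alpha> \<beta> s =
      ((Gamma (1 + s) * Gamma (1 + s / of_real \<alpha>)) * Gamma (- (s / of_real \<alpha>))) /
      (Gamma (- (s / 2)) * (Gamma (of_real \<beta> + of_real \<beta> * s / of_real \<alpha>) * Gamma (1 + s / 2)))"
    unfolding fox_theta_def lens sets by simp
  then show ?thesis
    by (simp only: rGamma_inverse_Gamma divide_inverse inverse_mult_distrib mult.assoc)
qed

text \<open>At integers the left side is 0, as the sine vanishes there, so they must be excluded.
  The companion for \<open>rGamma\<close> is an identity between entire functions and holds
  everywhere.\<close>

lemma Gamma_Gamma_sin:
  fixes w :: complex
  assumes "sin (of_real pi * w) \<noteq> 0"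
  shows "Gamma (1 + w) * Gamma (- w) * sin (of_real pi * w) = - of_real pi"
  using Gamma_reflection_complex[of "-w"] assms by (simp add: field_simps)

lemma rGamma_rGamma_sin:
  fixes w :: complex
  shows "rGamma (1 + w) * rGamma (- w) = - sin (of_real pi * w) / of_real pi"
  using rGamma_reflection_complex[of "-w"] by (simp add: mult_ac)

lemma sin_of_real_mult_neq_0:
  fixes s :: complex
  assumes "sin (of_real r * s) = 0" "r \<noteq> 0"
  shows "Im s = 0"
proof -
  obtain n :: int where "of_real r * s = of_real (of_int n * pi)"
    using assms(1) by (auto simp: Complex_Transcendental.sin_eq_0)
  then have "Im (of_real r * s) = 0" by (simp only: Im_complex_of_real)
  then show ?thesis using assms by simp
qed

text \<open>Reflection is applied to two pairs: the factors in s/\<alpha> give the sine in the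
  denominator, those in s/2 the sine in the numerator, and the two factors -\<pi> cancel.\<close>

lemma diffusion_theta_sin:
  assumes "sin (of_real (pi / \<alpha>) * s) \<noteq> 0"
  shows "diffusion_theta \<alpha> \<beta> s =
     sin (of_real (pi / 2) * s) / sin (of_real (pi / \<alpha>) * s) *
     Gamma (1 + s) * rGamma (of_real \<beta> + of_real \<beta> * s / of_real \<alpha>)"
proof -
  have 1: "Gamma (1 + s / of_real \<alpha>) * Gamma (- (s / of_real \<alpha>)) = - of_real pi / sin (of_real (pi / \<alpha>) * s)"
    using Gamma_Gamma_sin[of "s / of_real \<alpha>"] assms by (simp add: divide_simps mult_ac)
  have 2: "rGamma (1 + s / 2) * rGamma (- (s / 2)) = - sin (of_real (pi / 2) * s) / of_real pi"
    using rGamma_rGamma_sin[of "s / 2"] by simp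
  have "diffusion_theta \<alpha> \<beta> s = (Gamma (1 + s / of_real \<alpha>) * Gamma (- (s / of_real \<alpha>))) *
     (rGamma (1 + s / 2) * rGamma (- (s / 2))) * Gamma (1 + s) * rGamma (of_real \<beta> + of_real \<beta> * s / of_real \<alpha>)"
    unfolding diffusion_theta_eq by (simp add: mult_ac)
  then show ?thesis unfolding 1 2 using assms by simp
qed

lemma diffusion_theta_decay:
  assumes "\<alpha> > 0" "0 < \<beta>" "\<beta> < 2"
  shows "\<exists>C\<ge>0. \<forall>s. A \<le> Re s \<and> Re s \<le> B \<and> \<bar>Im s\<bar> \<ge> 1 \<longrightarrow>
           norm (diffusion_theta \<alpha> \<beta> s) \<le> C / (1 + (Im s)\<^sup>2)"
proof -
  obtain C1 N1 where C1: "C1 \<ge> 0" "\<And>x y. - B \<le> x \<Longrightarrow> x \<le> - A \<Longrightarrow>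
      norm (rGamma (Complex x y)) \<le> C1 * (1 + \<bar>y\<bar>) ^ N1 * exp (pi * \<bar>y\<bar> / 2)"
    using norm_rGamma_strip_bound by metis
  obtain C2 N2 where C2: "C2 \<ge> 0" "\<And>x y. \<beta> + \<beta> * A / \<alpha> \<le> x \<Longrightarrow> x \<le> \<beta> + \<beta> * B / \<alpha> \<Longrightarrow>
      norm (rGamma (Complex x y)) \<le> C2 * (1 + \<bar>y\<bar>) ^ N2 * exp (pi * \<bar>y\<bar> / 2)"
    using norm_rGamma_strip_bound by metis
  \<comment> \<open>The exponential rates in \<bar>Im s\<bar> are \<pi>/2 from the upper sine,
    -\<pi>/\<alpha> from the lower one, -\<pi>/2 from \<Gamma>(1 + s) and \<pi>\<beta>/(2\<alpha>)
    from the last factor. They sum to -k, and \<beta> < 2 makes k positive.\<close>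
  define k where "k = pi * (2 - \<beta>) / (2 * \<alpha>)"
  have "k > 0" using assms by (simp add: k_def)
  \<comment> \<open>The degrees \<open>N1\<close> and \<open>N2\<close> come from the two strip
    bounds; the additional 2 pays for 1 + y^2 \<le> (1 + y)^2.\<close>
  obtain K where K: "K \<ge> 0" "\<And>t. t \<ge> 0 \<Longrightarrow> (1 + t) ^ (N1 + N2 + 2) * exp (- (k * t)) \<le> K"
    using poly_exp_bound[OF \<open>k > 0\<close>] by metis
  define e where "e r = (1 - exp (-2 * r)) / 2" for r :: real
  have e: "e r > 0" if "r > 0" for r using that by (simp add: e_def)
  define L where "L = (1 / e (pi / \<alpha>)) * (pi / e pi * C1) * (C2 * (1 + \<beta> / \<alpha>) ^ N2)"
  have L: "L \<ge> 0" unfolding L_def using e[of "pi/\<alpha>"] e[of pi] C1(1) C2(1) assms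
    by (intro mult_nonneg_nonneg) auto
  have "norm (diffusion_theta \<alpha> \<beta> s) \<le> L * K / (1 + (Im s)\<^sup>2)"
    if s: "A \<le> Re s" "Re s \<le> B" "\<bar>Im s\<bar> \<ge> 1" for s
  proof -
    define y where "y = \<bar>Im s\<bar>"
    have y: "y \<ge> 1" using s by (simp add: y_def)
    have "Im s \<noteq> 0" using s by auto
    have nz: "sin (of_real (pi / \<alpha>) * s) \<noteq> 0"
      using sin_of_real_mult_neq_0[of "pi / \<alpha>" s] \<open>Im s \<noteq> 0\<close> assms by auto
    have nz1: "sin (of_real pi * s) \<noteq> 0"
      using sin_of_real_mult_neq_0[of pi s] \<open>Im s \<noteq> 0\<close> by auto
    have b1: "norm (sin (of_real (pi / 2) * s)) \<le> exp (pi / 2 * y)"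
      using norm_sin_complex_le[of "of_real (pi / 2) * s"] by (simp add: y_def abs_mult)
    have b2: "norm (inverse (sin (of_real (pi / \<alpha>) * s))) \<le> 1 / e (pi / \<alpha>) * exp (- (pi / \<alpha> * y))"
    proof -
      have "e (pi / \<alpha>) * exp (pi / \<alpha> * y) \<le> norm (sin (of_real (pi / \<alpha>) * s))"
        using norm_sin_complex_ge[of "pi / \<alpha>" "of_real (pi / \<alpha>) * s"] assms y
        by (simp add: y_def abs_mult e_def divide_simps)
      then have "inverse (norm (sin (of_real (pi / \<alpha>) * s))) \<le> inverse (e (pi / \<alpha>) * exp (pi / \<alpha> * y))"
        using e[of "pi / \<alpha>"] assms by (intro le_imp_inverse_le) auto
      then show ?thesis by (simp only: norm_inverse inverse_mult_distrib exp_minus divide_inverse mult_1)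
    qed
    \<comment> \<open>\<Gamma>(1 + s) = -\<pi> \<open>rGamma (- s)\<close> / sin(\<pi>s), so a bound
      on 1/\<Gamma> in the reflected strip bounds \<Gamma> itself. The condition \<bar>Im s\<bar>
      \<ge> 1 keeps sin(\<pi>s) away from its zeros; the net rate is \<pi>/2 - \<pi>.\<close>
    have b3: "norm (Gamma (1 + s)) \<le> (pi / e pi * C1) * ((1 + y) ^ N1 * exp (- (pi / 2 * y)))"
    proof -
      have "rGamma (1 + s) * rGamma (- s) \<noteq> 0" unfolding rGamma_rGamma_sin using nz1 by simp
      then have rg: "rGamma (1 + s) \<noteq> 0" by auto
      have "Gamma (1 + s) * sin (of_real pi * s) = - of_real pi * rGamma (- s)"
        using rGamma_rGamma_sin[of s] rg by (simp add: Gamma_def field_simps)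
      then have "Gamma (1 + s) = - of_real pi * rGamma (- s) * inverse (sin (of_real pi * s))"
        using nz1 by (simp add: field_simps)
      then have "norm (Gamma (1 + s)) = pi * norm (rGamma (- s)) * inverse (norm (sin (of_real pi * s)))"
        by (simp add: norm_mult norm_inverse)
      also have "\<dots> \<le> pi * (C1 * (1 + y) ^ N1 * exp (pi * y / 2)) * inverse (e pi * exp (pi * y))"
      proof (intro mult_mono le_imp_inverse_le)
        show "norm (rGamma (- s)) \<le> C1 * (1 + y) ^ N1 * exp (pi * y / 2)"
          using C1(2)[of "- Re s" "- Im s"] s by (simp add: y_def flip: complex_minus)
        show "e pi * exp (pi * y) \<le> norm (sin (of_real pi * s))"
          using norm_sin_complex_ge[of "pi" "of_real pi * s"] y by (simp add: y_def abs_mult e_def)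
      qed (use e[of pi] C1(1) y in auto)
      also have "\<dots> = (pi / e pi * C1) * ((1 + y) ^ N1 * (exp (pi * y / 2) * exp (- (pi * y))))"
        using e[of pi] by (simp add: exp_minus divide_simps)
      also have "exp (pi * y / 2) * exp (- (pi * y)) = exp (- (pi / 2 * y))"
        by (simp flip: exp_add)
      finally show ?thesis .
    qed
    have b4: "norm (rGamma (of_real \<beta> + of_real \<beta> * s / of_real \<alpha>)) \<le>
        C2 * (1 + \<beta> / \<alpha>) ^ N2 * ((1 + y) ^ N2 * exp (pi * \<beta> / (2 * \<alpha>) * y))"
    proof -
      have 1: "of_real \<beta> + of_real \<beta> * s / of_real \<alpha> = Complex (\<beta> + \<beta> * Re s / \<alpha>) (\<beta> * Im s / \<alpha>)"
        by (auto simp: complex_eq_iff)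
      have 2: "\<bar>\<beta> * Im s / \<alpha>\<bar> = \<beta> / \<alpha> * y" using assms by (simp add: y_def abs_mult)
      have "norm (rGamma (of_real \<beta> + of_real \<beta> * s / of_real \<alpha>)) \<le>
          C2 * (1 + \<beta> / \<alpha> * y) ^ N2 * exp (pi * (\<beta> / \<alpha> * y) / 2)"
        unfolding 1 2[symmetric] using s assms
        by (intro C2(2)) (auto intro!: divide_right_mono mult_left_mono)
      also have "\<dots> \<le> C2 * ((1 + \<beta> / \<alpha>) * (1 + y)) ^ N2 * exp (pi * (\<beta> / \<alpha> * y) / 2)"
        using assms C2(1) y
        by (intro mult_left_mono mult_right_mono power_mono) (auto simp: distrib_left distrib_right)
      finally show ?thesis by (simp add: power_mult_distrib mult_ac)
    qed
    have "norm (diffusion_theta \<alpha> \<beta> s) = norm (sin (of_real (pi / 2) * s)) *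
        norm (inverse (sin (of_real (pi / \<alpha>) * s))) * norm (Gamma (1 + s)) *
        norm (rGamma (of_real \<beta> + of_real \<beta> * s / of_real \<alpha>))"
      unfolding diffusion_theta_sin[OF nz] by (simp only: norm_mult norm_divide norm_inverse divide_inverse)
    also have "\<dots> \<le> exp (pi / 2 * y) * (1 / e (pi / \<alpha>) * exp (- (pi / \<alpha> * y))) *
        ((pi / e pi * C1) * ((1 + y) ^ N1 * exp (- (pi / 2 * y)))) *
        (C2 * (1 + \<beta> / \<alpha>) ^ N2 * ((1 + y) ^ N2 * exp (pi * \<beta> / (2 * \<alpha>) * y)))"
      using e[of "pi/\<alpha>"] e[of pi] C1(1) assms y
      by (intro mult_mono b1 b2 b3 b4 mult_nonneg_nonneg) auto
    also have "\<dots> = L * ((1 + y) ^ (N1 + N2) *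
        (exp (pi / 2 * y) * exp (- (pi / \<alpha> * y)) * exp (- (pi / 2 * y)) * exp (pi * \<beta> / (2 * \<alpha>) * y)))"
      by (simp only: L_def power_add mult_ac)
    also have "exp (pi / 2 * y) * exp (- (pi / \<alpha> * y)) * exp (- (pi / 2 * y)) * exp (pi * \<beta> / (2 * \<alpha>) * y) = exp (- (k * y))"
    proof -
      have "pi / 2 * y + - (pi / \<alpha> * y) + - (pi / 2 * y) + pi * \<beta> / (2 * \<alpha>) * y = - (k * y)"
        using assms by (simp add: k_def field_simps)
      then show ?thesis by (metis exp_add)
    qed
    also have "L * ((1 + y) ^ (N1 + N2) * exp (- (k * y))) \<le> L * (K / (1 + y\<^sup>2))"
    proof (intro mult_left_mono L)
      have "(1 + y) ^ (N1 + N2) * exp (- (k * y)) * (1 + y\<^sup>2) \<le> (1 + y) ^ (N1 + N2) * exp (- (k * y)) * (1 + y)\<^sup>2"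
        using y by (intro mult_left_mono) (auto simp: power2_eq_square algebra_simps)
      also have "\<dots> = (1 + y) ^ (N1 + N2 + 2) * exp (- (k * y))"
        by (simp only: power_add mult_ac)
      also have "\<dots> \<le> K" by (rule K(2)) (use y in simp)
      finally show "(1 + y) ^ (N1 + N2) * exp (- (k * y)) \<le> K / (1 + y\<^sup>2)"
        by (subst pos_le_divide_eq) (auto intro: add_pos_nonneg)
    qed
    finally show ?thesis by (simp add: y_def)
  qed
  then show ?thesis using L K(1) by (intro exI[of _ "L * K"]) auto
qed

section \<open>Integrals along vertical lines\<close>

lemma integrable_quadratic_decay:
  fixes f :: "real \<Rightarrow> complex"
  assumes cont: "continuous_on UNIV f" and decay: "\<And>y. \<bar>y\<bar> \<ge> Y \<Longrightarrow> norm (f y) \<le> C / (1 + y\<^sup>2)"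
  shows "integrable lborel f"
proof -
  have pos: "1 + y\<^sup>2 > 0" for y :: real by (simp add: add_pos_nonneg)
  have "compact ((\<lambda>y. norm (f y) * (1 + y\<^sup>2)) ` {-\<bar>Y\<bar>..\<bar>Y\<bar>})"
    by (intro compact_continuous_image continuous_intros continuous_on_subset[OF cont]) auto
  then obtain D where D: "\<And>y. y \<in> {-\<bar>Y\<bar>..\<bar>Y\<bar>} \<Longrightarrow> norm (norm (f y) * (1 + y\<^sup>2)) \<le> D"
    using bounded_iff compact_imp_bounded by (metis (no_types, lifting) imageI)
  have *: "norm (f y) \<le> max C D * inverse (1 + y\<^sup>2)" for y
  proof (cases "\<bar>y\<bar> \<ge> Y")
    case True
    then have "norm (f y) \<le> C / (1 + y\<^sup>2)" by (rule decay)
    also have "\<dots> \<le> max C D / (1 + y\<^sup>2)" using pos[of y] by (intro divide_right_mono) auto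
    finally show ?thesis by (simp add: divide_inverse)
  next
    case False
    then have "norm (f y) * (1 + y\<^sup>2) \<le> D" using D[of y] by (simp add: abs_le_iff) linarith
    then have "norm (f y) \<le> D / (1 + y\<^sup>2)" using pos[of y] by (simp add: pos_le_divide_eq)
    also have "\<dots> \<le> max C D / (1 + y\<^sup>2)" using pos[of y] by (intro divide_right_mono) auto
    finally show ?thesis by (simp add: divide_inverse)
  qed
  have "integrable lborel (\<lambda>y::real. max C D * inverse (1 + y\<^sup>2))"
    using integrable_inverse_1_plus_square by (simp add: set_integrable_def)
  then show ?thesis
  proof (rule Bochner_Integration.integrable_bound)
    show "f \<in> borel_measurable lborel" using cont by (simp add: borel_measurable_continuous_onI)
    show "AE y in lborel. norm (f y) \<le> norm (max C D * inverse (1 + y\<^sup>2))"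
      using * by (intro AE_I2) (metis abs_ge_self order_trans real_norm_def)
  qed
qed

text \<open>A gauge integral over the line is the limit of its truncations however fast each end
  runs off, without absolute convergence. Contours that converge only conditionally are reached
  through this limit.\<close>

lemma integral_tendsto_has_integral_UNIV:
  fixes f :: "real \<Rightarrow> complex"
  assumes f: "(f has_integral I) UNIV" and a: "filterlim a at_bot G" and b: "filterlim b at_top G"
  shows "((\<lambda>t. integral {a t..b t} f) \<longlongrightarrow> I) G"
proof (rule tendstoI)
  fix e :: real assume "e > 0"
  then obtain B where B: "B > 0" "\<And>a b. ball 0 B \<subseteq> cbox a b \<Longrightarrow> norm (integral (cbox a b) f - I) < e"
    using f[unfolded has_integral_alt'[of f I UNIV]] by auto
  have "eventually (\<lambda>t. a t \<le> - B) G" "eventually (\<lambda>t. B \<le> b t) G"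
    using a b by (auto simp: filterlim_at_bot filterlim_at_top)
  then show "eventually (\<lambda>t. dist (integral {a t..b t} f) I < e) G"
  proof eventually_elim
    case (elim t)
    have "ball 0 B \<subseteq> cbox (a t) (b t)" using elim by (auto simp: dist_real_def)
    from B(2)[OF this] show ?case by (simp add: dist_norm)
  qed
qed

text \<open>The segments have fixed length while the integrand on them is O(1/y^2). The height is an
  arbitrary function along a filter, since the two ends of a contour may rise at different
  speeds.\<close>

lemma linepath_quadratic_decay_tendsto:
  assumes int: "eventually (\<lambda>t. F contour_integrable_on linepath (Complex c1 (y t)) (Complex c2 (y t))) G"
    and decay: "\<And>s. Re s \<in> closed_segment c1 c2 \<Longrightarrow> \<bar>Im s\<bar> \<ge> Y \<Longrightarrow> norm (F s) \<le> C / (1 + (Im s)\<^sup>2)"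
    and y: "filterlim (\<lambda>t. \<bar>y t\<bar>) at_top G"
  shows "((\<lambda>t. contour_integral (linepath (Complex c1 (y t)) (Complex c2 (y t))) F) \<longlongrightarrow> 0) G"
proof (rule Lim_null_comparison)
  have "eventually (\<lambda>t. \<bar>y t\<bar> \<ge> Y) G" using y by (simp add: filterlim_at_top)
  with int show "eventually (\<lambda>t. norm (contour_integral (linepath (Complex c1 (y t)) (Complex c2 (y t))) F)
      \<le> \<bar>C\<bar> / (1 + (y t)\<^sup>2) * norm (complex_of_real (c2 - c1))) G"
  proof eventually_elim
    case (elim t)
    have "norm (contour_integral (linepath (Complex c1 (y t)) (Complex c2 (y t))) F)
      \<le> \<bar>C\<bar> / (1 + (y t)\<^sup>2) * norm (Complex c2 (y t) - Complex c1 (y t))"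
    proof (rule contour_integral_bound_linepath[OF elim(1)])
      fix s assume s: "s \<in> closed_segment (Complex c1 (y t)) (Complex c2 (y t))"
      then have 1: "Im s = y t" "Re s \<in> closed_segment c1 c2"
        by (auto simp: closed_segment_same_Im)
      have "norm (F s) \<le> C / (1 + (y t)\<^sup>2)" using decay[of s] 1 elim by simp
      also have "\<dots> \<le> \<bar>C\<bar> / (1 + (y t)\<^sup>2)" by (intro divide_right_mono) (auto intro: add_nonneg_nonneg)
      finally show "norm (F s) \<le> \<bar>C\<bar> / (1 + (y t)\<^sup>2)" .
    qed (auto intro: add_nonneg_nonneg)
    also have "Complex c2 (y t) - Complex c1 (y t) = of_real (c2 - c1)" by (simp add: complex_eq_iff)
    finally show ?case .
  qed
  have "filterlim (\<lambda>t. 1 + (y t)\<^sup>2) at_top G"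
  proof -
    have "filterlim (\<lambda>t. \<bar>y t\<bar> ^ 2) at_top G" by (rule filterlim_pow_at_top[OF _ y]) auto
    then show ?thesis by (intro filterlim_tendsto_add_at_top[OF tendsto_const]) auto
  qed
  then have "((\<lambda>t. \<bar>C\<bar> / (1 + (y t)\<^sup>2) * norm (complex_of_real (c2 - c1))) \<longlongrightarrow> 0 * norm (complex_of_real (c2 - c1))) G"
    by (intro tendsto_mult tendsto_const tendsto_divide_0[OF tendsto_const] filterlim_at_top_imp_at_infinity)
  then show "((\<lambda>t. \<bar>C\<bar> / (1 + (y t)\<^sup>2) * norm (complex_of_real (c2 - c1))) \<longlongrightarrow> 0) G" by simp
qed

lemma vertical_line_tendsto:
  assumes cont: "continuous_on UNIV (\<lambda>y. F (Complex c y))"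
    and decay: "\<And>y. \<bar>y\<bar> \<ge> Y \<Longrightarrow> norm (F (Complex c y)) \<le> C / (1 + y\<^sup>2)"
    and a: "filterlim a at_bot G" and b: "filterlim b at_top G"
  shows "((\<lambda>t. contour_integral (linepath (Complex c (a t)) (Complex c (b t))) F)
            \<longlongrightarrow> \<i> * (LINT y|lborel. F (Complex c y))) G"
proof -
  have "integrable lborel (\<lambda>y. F (Complex c y))"
    by (rule integrable_quadratic_decay[OF cont decay])
  then have "((\<lambda>y. F (Complex c y)) has_integral (LINT y|lborel. F (Complex c y))) UNIV"
    by (rule has_integral_integral_lborel)
  then have "((\<lambda>t. integral {a t..b t} (\<lambda>y. F (Complex c y))) \<longlongrightarrow> (LINT y|lborel. F (Complex c y))) G"
    by (rule integral_tendsto_has_integral_UNIV[OF _ a b])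
  then have lim: "((\<lambda>t. \<i> * integral {a t..b t} (\<lambda>y. F (Complex c y))) \<longlongrightarrow> \<i> * (LINT y|lborel. F (Complex c y))) G"
    by (intro tendsto_intros)
  have "eventually (\<lambda>t. a t \<le> 0) G" "eventually (\<lambda>t. 1 \<le> b t) G"
    using a b by (auto simp: filterlim_at_bot filterlim_at_top)
  then have "eventually (\<lambda>t. \<i> * integral {a t..b t} (\<lambda>y. F (Complex c y)) =
      contour_integral (linepath (Complex c (a t)) (Complex c (b t))) F) G"
  proof eventually_elim
    case (elim t)
    then show ?case
      by (subst contour_integral_linepath_same_Re[of _ c _ "a t" "b t"]) auto
  qed
  then show ?thesis by (rule Lim_transform_eventually[OF lim])
qed

text \<open>\<open>L\<close> is the common value of the integrals over all sufficiently high rectangles: \<open>0\<close>, or the residue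
  contribution of the poles in the strip.\<close>

lemma strip_contour_shift:
  assumes c: "c1 < c2"
    and cont: "\<And>c. c \<in> {c1, c2} \<Longrightarrow> continuous_on UNIV (\<lambda>y. F (Complex c y))"
    and decay: "\<And>s. c1 \<le> Re s \<Longrightarrow> Re s \<le> c2 \<Longrightarrow> \<bar>Im s\<bar> \<ge> Y \<Longrightarrow> norm (F s) \<le> C / (1 + (Im s)\<^sup>2)"
    and rect: "\<And>T. T \<ge> Y \<Longrightarrow> (F has_contour_integral L) (rectpath (Complex c1 (- T)) (Complex c2 T))"
  shows "\<i> * ((LINT y|lborel. F (Complex c2 y)) - (LINT y|lborel. F (Complex c1 y))) = L"
proof -
  define V where "V c T = contour_integral (linepath (Complex c (- T)) (Complex c T)) F" for c T
  define Hz where "Hz y = contour_integral (linepath (Complex c1 y) (Complex c2 y)) F" for y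
  have ev: "eventually (\<lambda>T. L = Hz (- T) + (V c2 T - (Hz T + V c1 T)) \<and>
      F contour_integrable_on linepath (Complex c1 (- T)) (Complex c2 (- T)) \<and>
      F contour_integrable_on linepath (Complex c1 T) (Complex c2 T)) at_top"
    using eventually_ge_at_top[of Y]
  proof eventually_elim
    case (elim T)
    have r: "(F has_contour_integral L) (linepath (Complex c1 (- T)) (Complex c2 (- T)) +++
        linepath (Complex c2 (- T)) (Complex c2 T) +++ linepath (Complex c2 T) (Complex c1 T) +++
        linepath (Complex c1 T) (Complex c1 (- T)))"
      using rect[OF elim] by (simp add: rectpath_def Let_def)
    then have ci: "F contour_integrable_on linepath (Complex c1 (- T)) (Complex c2 (- T))"
        "F contour_integrable_on linepath (Complex c2 (- T)) (Complex c2 T)"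
        "F contour_integrable_on linepath (Complex c2 T) (Complex c1 T)"
        "F contour_integrable_on linepath (Complex c1 T) (Complex c1 (- T))"
      by (auto dest!: has_contour_integral_integrable)
    have rev: "contour_integral (linepath b a) F = - contour_integral (linepath a b) F" for a b
      using contour_integral_reversepath[of "linepath a b" F] by simp
    have "L = Hz (- T) + (V c2 T + (contour_integral (linepath (Complex c2 T) (Complex c1 T)) F +
        contour_integral (linepath (Complex c1 T) (Complex c1 (- T))) F))"
      using contour_integral_unique[OF r] ci by (simp add: Hz_def V_def)
    also have "\<dots> = Hz (- T) + (V c2 T - (Hz T + V c1 T))"
      unfolding rev[of "Complex c2 T"] rev[of "Complex c1 T" "Complex c1 (- T)"]
      by (simp add: Hz_def V_def)
    finally show ?case using ci
      by (metis contour_integrable_reversepath_eq reversepath_linepath valid_path_linepath)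
  qed
  have seg: "Re s \<in> closed_segment c1 c2 \<longleftrightarrow> c1 \<le> Re s \<and> Re s \<le> c2" for s
    using c by (auto simp: closed_segment_eq_real_ivl)
  have H1: "((\<lambda>T. Hz T) \<longlongrightarrow> 0) at_top"
    unfolding Hz_def by (rule linepath_quadratic_decay_tendsto[where Y = Y and C = C])
      (use ev decay seg in \<open>auto elim!: eventually_mono intro: filterlim_abs_real\<close>)
  have H2: "((\<lambda>T. Hz (- T)) \<longlongrightarrow> 0) at_top"
    unfolding Hz_def by (rule linepath_quadratic_decay_tendsto[where Y = Y and C = C])
      (use ev decay seg in \<open>auto elim!: eventually_mono intro: filterlim_abs_real\<close>)
  have V: "((\<lambda>T. V c T) \<longlongrightarrow> \<i> * (LINT y|lborel. F (Complex c y))) at_top" if "c \<in> {c1, c2}" for c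
    unfolding V_def
  proof (intro vertical_line_tendsto[where Y = Y and C = C] cont that filterlim_uminus_at_bot_at_top filterlim_ident)
    show "norm (F (Complex c y)) \<le> C / (1 + y\<^sup>2)" if "Y \<le> \<bar>y\<bar>" for y
      using decay[of "Complex c y"] that \<open>c \<in> {c1, c2}\<close> \<open>c1 < c2\<close> by auto
  qed
  have "((\<lambda>T. Hz (- T) + (V c2 T - (Hz T + V c1 T))) \<longlongrightarrow>
      0 + (\<i> * (LINT y|lborel. F (Complex c2 y)) - (0 + \<i> * (LINT y|lborel. F (Complex c1 y))))) at_top"
    by (intro tendsto_intros H1 H2 V) auto
  moreover have "((\<lambda>T. Hz (- T) + (V c2 T - (Hz T + V c1 T))) \<longlongrightarrow> L) at_top"
    using ev by (intro tendsto_eventually) (auto elim!: eventually_mono)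
  ultimately show ?thesis using tendsto_unique[OF trivial_limit_at_top_linorder]
    by (metis (no_types, lifting) add_0 right_diff_distrib)
qed

section \<open>Independence of the separating contour\<close>

text \<open>Detour from the line \<open>Re = c\<close> to the far away line \<open>Re = \<rho>\<close>.  The resulting loop no longer meets the connected
  set \<open>S\<close>, so it has the same winding number about \<open>p\<close> as about \<open>p'\<close>, which lies outside a half-plane
  containing it; the rectangle between the two lines does not encircle \<open>p\<close> either.\<close>

lemma winding_number_closing_eq_0:
  assumes g: "path g" "pathstart g = Complex \<gamma> y1" "pathfinish g = Complex \<gamma> y2"
    and p: "Im p = 0" "y1 < 0" "0 < y2" "Re p \<noteq> c" "p \<notin> path_image g"
    and S: "connected S" "p \<in> S" "p' \<in> S" "S \<inter> path_image g = {}"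
      "\<And>s. s \<in> S \<Longrightarrow> y1 < Im s \<and> Im s < y2 \<and> Re s \<noteq> \<rho>"
    and H1: "convex H" "p' \<notin> H" "path_image g \<subseteq> H"
      "\<And>y. Complex \<gamma> y \<in> H \<and> Complex c y \<in> H \<and> Complex \<rho> y \<in> H"
    and H2: "convex K" "p \<notin> K" "\<And>y. Complex c y \<in> K \<and> Complex \<rho> y \<in> K"
  shows "winding_number (g +++ linepath (Complex \<gamma> y2) (Complex c y2) +++
           linepath (Complex c y2) (Complex c y1) +++ linepath (Complex c y1) (Complex \<gamma> y1)) p = 0"
proof -
  define A B A' B' A'' B'' where pts: "A = Complex \<gamma> y1" "B = Complex \<gamma> y2"
    "A' = Complex c y1" "B' = Complex c y2" "A'' = Complex \<rho> y1" "B'' = Complex \<rho> y2"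
  define loop where "loop = g +++ linepath B B' +++ linepath B' B'' +++ linepath B'' A'' +++
      linepath A'' A' +++ linepath A' A"
  define rect where "rect = linepath A' B' +++ linepath B' B'' +++ linepath B'' A'' +++ linepath A'' A'"
  have g': "pathstart g = A" "pathfinish g = B" using g by (auto simp: pts)
  have seg: "s \<notin> closed_segment B B'" "s \<notin> closed_segment B' B''" "s \<notin> closed_segment B'' A''"
      "s \<notin> closed_segment A'' A'" "s \<notin> closed_segment A' A" if "s \<in> S" for s
    using S(5)[OF that] by (auto simp: pts closed_segment_same_Im closed_segment_same_Re)
  have pseg: "p \<notin> closed_segment A' B'" "p \<notin> closed_segment B' A'"
    using p by (auto simp: pts closed_segment_same_Re)
  have H1': "A \<in> H" "B \<in> H" "A' \<in> H" "B' \<in> H" "A'' \<in> H" "B'' \<in> H"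
    using H1(4) by (auto simp: pts)
  have H2': "A' \<in> K" "B' \<in> K" "A'' \<in> K" "B'' \<in> K"
    using H2(3) by (auto simp: pts)
  have "winding_number loop p = winding_number loop p'"
  proof (rule winding_number_eq[OF _ _ S(2,3,1)])
    show "S \<inter> path_image loop = {}"
      using S(4) seg by (auto simp: loop_def path_image_join g')
  qed (auto simp: loop_def g(1) g')
  also have "\<dots> = 0"
    using H1 H1' by (intro winding_number_zero_outside[of _ H])
      (auto simp: loop_def g(1) g' path_image_join closed_segment_subset[OF _ _ H1(1)] dest!: closed_segment_subset[OF _ _ H1(1), THEN subsetD, rotated 2])
  finally have 1: "winding_number loop p = 0" .
  have 2: "winding_number rect p = 0"
    using H2 H2' by (intro winding_number_zero_outside[of _ K])
      (auto simp: rect_def path_image_join dest!: closed_segment_subset[OF _ _ H2(1), THEN subsetD, rotated 2])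
  note seg = seg[OF S(2)]
  have rev: "winding_number (linepath B' A') p = - winding_number (linepath A' B') p"
    using winding_number_reversepath[of "linepath A' B'" p] pseg by simp
  have "winding_number loop p = winding_number g p + (winding_number (linepath B B') p +
     (winding_number (linepath B' B'') p + (winding_number (linepath B'' A'') p +
     (winding_number (linepath A'' A') p + winding_number (linepath A' A) p))))"
    using seg p(5) g(1) g' by (simp add: loop_def winding_number_join path_image_join)
  moreover have "winding_number rect p = winding_number (linepath A' B') p +
     (winding_number (linepath B' B'') p + (winding_number (linepath B'' A'') p +
     winding_number (linepath A'' A') p))"
    using seg pseg by (simp add: rect_def winding_number_join path_image_join)
  \<comment> \<open>\<open>loop\<close> and \<open>rect\<close> share the detour B', B'', A'', A'.
    In the difference of their winding numbers it is therefore replaced by the reversed segment from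
    B' to A', which is exactly the loop closed along the line Re = c.\<close>
  moreover have "winding_number (g +++ linepath B B' +++ linepath B' A' +++ linepath A' A) p =
     winding_number g p + (winding_number (linepath B B') p + (winding_number (linepath B' A') p +
     winding_number (linepath A' A) p))"
    using seg pseg p(5) g(1) g' by (simp add: winding_number_join path_image_join)
  ultimately have "winding_number (g +++ linepath B B' +++ linepath B' A' +++ linepath A' A) p =
      winding_number loop p - winding_number rect p"
    using rev by simp
  then show ?thesis using 1 2 by (simp add: pts)
qed

section \<open>Truncations of a contour over the whole line\<close>

definition truncation :: "(real \<Rightarrow> complex) \<Rightarrow> real \<Rightarrow> real \<Rightarrow> complex" where
  "truncation \<Omega> s = (\<lambda>u. \<Omega> (2 * s * u - s))"

lemma pathstart_truncation [simp]: "pathstart (truncation \<Omega> s) = \<Omega> (- s)"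
  and pathfinish_truncation [simp]: "pathfinish (truncation \<Omega> s) = \<Omega> s"
  by (auto simp: truncation_def pathstart_def pathfinish_def)

lemma path_image_truncation_subset: "path_image (truncation \<Omega> s) \<subseteq> range \<Omega>"
  by (auto simp: truncation_def path_image_def)

lemma valid_path_truncation:
  assumes "\<Omega> piecewise_C1_differentiable_on UNIV"
  shows "valid_path (truncation \<Omega> s)"
  using piecewise_C1_differentiable_affine[of \<Omega> "2 * s" "- s" "{0..1}"]
    piecewise_C1_differentiable_on_subset[OF assms]
  by (auto simp: valid_path_def truncation_def o_def)

lemma contour_integral_truncation:
  assumes \<Omega>: "\<Omega> piecewise_C1_differentiable_on UNIV" and "s > 0"
    and int: "(\<lambda>t. F (\<Omega> t) * vector_derivative \<Omega> (at t)) integrable_on {-s..s}"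
  shows "contour_integral (truncation \<Omega> s) F = integral {-s..s} (\<lambda>t. F (\<Omega> t) * vector_derivative \<Omega> (at t))"
proof (rule contour_integral_unique)
  define f where "f t = F (\<Omega> t) * vector_derivative \<Omega> (at t)" for t
  define J where "J = integral {-s..s} f"
  from \<Omega> obtain N where N: "finite N" "\<Omega> C1_differentiable_on (UNIV - N)"
    unfolding piecewise_C1_differentiable_on_def by auto
  have "(f has_integral J) (cbox (- s) s)"
    using int by (simp add: J_def f_def[abs_def] integrable_integral)
  then have "((\<lambda>u. f (2 * s * u - s)) has_integral J /\<^sub>R (2 * s)) {0..1}"
    using has_integral_affinity_iff[of "2 * s" f "- s" J "- s" s] \<open>s > 0\<close> by simp
  then have "((\<lambda>u. of_real (2 * s) * f (2 * s * u - s)) has_integral of_real (2 * s) * (J /\<^sub>R (2 * s))) {0..1}"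
    by (rule has_integral_mult_right)
  also have "of_real (2 * s) * (J /\<^sub>R (2 * s)) = J" using \<open>s > 0\<close> by (simp add: scaleR_conv_of_real field_simps)
  finally have "((\<lambda>u. of_real (2 * s) * f (2 * s * u - s)) has_integral J) {0..1}" .
  \<comment> \<open>The chain rule is available except at the preimages of the finitely many break
    points of the contour, which the integral does not see.\<close>
  then have "((\<lambda>u. F (truncation \<Omega> s u) * vector_derivative (truncation \<Omega> s) (at u)) has_integral J) {0..1}"
  proof (rule has_integral_spike_finite[rotated 2])
    show "finite ((\<lambda>u. 2 * s * u - s) -` N)"
      using \<open>s > 0\<close> by (intro finite_vimageI N injI) auto
    fix u assume "u \<in> {0..1} - (\<lambda>u. 2 * s * u - s) -` N"
    then have "\<Omega> differentiable (at (2 * s * u - s))"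
      using N(2) by (auto simp: C1_differentiable_on_eq)
    then have "(\<Omega> has_vector_derivative vector_derivative \<Omega> (at (2 * s * u - s))) (at (2 * s * u - s))"
      by (simp add: vector_derivative_works)
    moreover have "((\<lambda>u. 2 * s * u - s) has_vector_derivative (2 * s)) (at u)"
      by (auto intro!: derivative_eq_intros simp flip: has_real_derivative_iff_has_vector_derivative)
    ultimately have "((\<Omega> \<circ> (\<lambda>u. 2 * s * u - s)) has_vector_derivative
        (2 * s) *\<^sub>R vector_derivative \<Omega> (at (2 * s * u - s))) (at u)"
      by (intro vector_diff_chain_at) auto
    then have "vector_derivative (truncation \<Omega> s) (at u) = (2 * s) *\<^sub>R vector_derivative \<Omega> (at (2 * s * u - s))"
      by (intro vector_derivative_at) (simp add: truncation_def o_def)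
    then show "F (truncation \<Omega> s u) * vector_derivative (truncation \<Omega> s) (at u) = of_real (2 * s) * f (2 * s * u - s)"
      by (simp add: f_def truncation_def scaleR_conv_of_real)
  qed
  then show "(F has_contour_integral integral {- s..s} (\<lambda>t. F (\<Omega> t) * vector_derivative \<Omega> (at t))) (truncation \<Omega> s)"
    by (simp add: has_contour_integral J_def f_def[abs_def])
qed

text \<open>Both ends leave every horizontal strip, so near a given point only a compact piece of
  the curve has to be avoided. Openness makes the components of the complement path connected, so
  that two poles on one side can be joined by a compact path off the contour.\<close>

lemma open_complement_vertical_contour:
  assumes cont: "continuous_on UNIV (\<Omega> :: real \<Rightarrow> complex)"
    and bot: "filterlim (\<lambda>t. Im (\<Omega> t)) at_bot at_bot" and top: "filterlim (\<lambda>t. Im (\<Omega> t)) at_top at_top"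
  shows "open (- range \<Omega>)"
proof (rule Topological_Spaces.openI)
  fix w assume w: "w \<in> - range \<Omega>"
  obtain T1 where T1: "\<And>t. t \<le> T1 \<Longrightarrow> Im (\<Omega> t) \<le> - (\<bar>Im w\<bar> + 1)"
    using bot by (auto simp: filterlim_at_bot eventually_at_bot_linorder)
  obtain T2 where T2: "\<And>t. t \<ge> T2 \<Longrightarrow> Im (\<Omega> t) \<ge> \<bar>Im w\<bar> + 1"
    using top by (auto simp: filterlim_at_top eventually_at_top_linorder)
  define N where "N = - (\<Omega> ` {T1..T2}) \<inter> ({s. Im s < \<bar>Im w\<bar> + 1} \<inter> {s. Im s > - (\<bar>Im w\<bar> + 1)})"
  have "closed (\<Omega> ` {T1..T2})"
    by (intro compact_imp_closed compact_continuous_image continuous_on_subset[OF cont]) auto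
  then have "open N" unfolding N_def
    by (intro open_Int open_halfspace_Im_lt open_halfspace_Im_gt) (auto simp: open_Compl)
  moreover have "w \<in> N" using w by (auto simp: N_def)
  moreover have "N \<subseteq> - range \<Omega>"
  proof
    fix s assume s: "s \<in> N"
    show "s \<in> - range \<Omega>"
    proof
      assume "s \<in> range \<Omega>"
      then obtain t where t: "s = \<Omega> t" by auto
      consider "t \<le> T1" | "t \<ge> T2" | "t \<in> {T1..T2}" by fastforce
      then show False using s T1[of t] T2[of t] by cases (auto simp: N_def t)
    qed
  qed
  ultimately show "\<exists>T. open T \<and> w \<in> T \<and> T \<subseteq> - range \<Omega>" by blast
qed

text \<open>Outside a compact parameter interval the contour consists of two rays on one vertical
  line. The resulting vertical strip contains only finitely many poles.\<close>

lemma bounded_Re_vertical_contour: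
  assumes cont: "continuous_on UNIV (\<Omega> :: real \<Rightarrow> complex)"
    and bot: "\<forall>\<^sub>F t in at_bot. Re (\<Omega> t) = \<gamma>" and top: "\<forall>\<^sub>F t in at_top. Re (\<Omega> t) = \<gamma>"
  shows "\<exists>R. \<forall>t. \<bar>Re (\<Omega> t)\<bar> \<le> R"
proof -
  obtain T1 where T1: "\<And>t. t \<le> T1 \<Longrightarrow> Re (\<Omega> t) = \<gamma>"
    using bot by (auto simp: eventually_at_bot_linorder)
  obtain T2 where T2: "\<And>t. t \<ge> T2 \<Longrightarrow> Re (\<Omega> t) = \<gamma>"
    using top by (auto simp: eventually_at_top_linorder)
  have "bounded ((\<lambda>t. Re (\<Omega> t)) ` {T1..T2})"
    by (intro compact_imp_bounded compact_continuous_image continuous_intros continuous_on_subset[OF cont]) auto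
  then obtain R where R: "\<forall>t\<in>{T1..T2}. \<bar>Re (\<Omega> t)\<bar> \<le> R"
    unfolding bounded_iff by auto
  have "\<bar>Re (\<Omega> t)\<bar> \<le> max R \<bar>\<gamma>\<bar>" for t
  proof -
    consider "t \<le> T1" | "t \<ge> T2" | "t \<in> {T1..T2}" by fastforce
    then show ?thesis using T1[of t] T2[of t] R by cases fastforce+
  qed
  then show ?thesis by blast
qed

text \<open>Points in the same component of the complement of the contour are joined by a path.  Its compactness
  keeps the closing segments off it once they are far enough away, whence the winding number about each
  pole vanishes eventually.  Only finitely many poles need this, the others being outside a strip containing the loop.\<close>

lemma vertical_contour_integral_eq:
  assumes \<Omega>: "L_vertical \<Omega>" "separates \<Omega> P Q"
    and PQ: "closed (P \<union> Q)" "\<And>R. finite {p \<in> P \<union> Q. \<bar>Re p\<bar> \<le> R}" "\<And>p. p \<in> P \<union> Q \<Longrightarrow> Im p = 0"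
    and P: "\<And>p. p \<in> P \<Longrightarrow> Re p < c" "\<And>R. \<exists>p\<in>P. Re p < - R"
    and Q: "\<And>q. q \<in> Q \<Longrightarrow> c < Re q" "\<And>R. \<exists>q\<in>Q. R < Re q"
    and F: "F holomorphic_on - (P \<union> Q)"
    and decay: "\<And>A B. \<exists>C. \<forall>s. A \<le> Re s \<and> Re s \<le> B \<and> \<bar>Im s\<bar> \<ge> 1 \<longrightarrow> norm (F s) \<le> C / (1 + (Im s)\<^sup>2)"
    and I: "((\<lambda>t. F (\<Omega> t) * vector_derivative \<Omega> (at t)) has_integral I) UNIV"
  shows "I = \<i> * (LINT y|lborel. F (Complex c y))"
proof -
  have pC1: "\<Omega> piecewise_C1_differentiable_on UNIV"
    and bot: "filterlim (\<lambda>t. Im (\<Omega> t)) at_bot at_bot" and top: "filterlim (\<lambda>t. Im (\<Omega> t)) at_top at_top"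
    using \<Omega> by (auto simp: L_vertical_def simple_contour_def)
  obtain \<gamma> where \<gamma>: "\<forall>\<^sub>F t in at_bot. Re (\<Omega> t) = \<gamma>" "\<forall>\<^sub>F t in at_top. Re (\<Omega> t) = \<gamma>"
    using \<Omega> by (auto simp: L_vertical_def)
  have cont: "continuous_on UNIV \<Omega>" using pC1 by (simp add: piecewise_C1_differentiable_on_def)
  obtain U V where U: "U \<in> components (- range \<Omega>)" "P \<subseteq> U" and V: "V \<in> components (- range \<Omega>)" "Q \<subseteq> V"
    using \<Omega> by (auto simp: separates_def)
  have sub: "U \<subseteq> - range \<Omega>" "V \<subseteq> - range \<Omega>"
    using U V in_components_subset by blast+
  have opn: "open (- range \<Omega>)" by (rule open_complement_vertical_contour[OF cont bot top])
  have pc: "path_connected U" "path_connected V"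
    using U V opn by (auto intro: connected_open_path_connected open_components in_components_connected)
  obtain R where R: "\<And>t. \<bar>Re (\<Omega> t)\<bar> \<le> R"
    using bounded_Re_vertical_contour[OF cont \<gamma>] by blast
  \<comment> \<open>The strip \<bar>Re s\<bar> \<le> \<open>R0\<close> contains the contour, the
    line of its end rays and the target line Re s = c.\<close>
  define R0 where "R0 = \<bar>R\<bar> + \<bar>c\<bar> + \<bar>\<gamma>\<bar>"
  define y1 y2 where "y1 s = Im (\<Omega> (- s))" and "y2 s = Im (\<Omega> s)" for s
  have y1: "filterlim y1 at_bot at_top" unfolding y1_def
    by (rule filterlim_compose[OF bot filterlim_uminus_at_bot_at_top])
  have y2: "filterlim y2 at_top at_top" unfolding y2_def by (rule top)
  have ev1: "\<forall>\<^sub>F s in at_top. y1 s < - M" and ev2: "\<forall>\<^sub>F s in at_top. M < y2 s" for M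
    using y1 y2 by (auto simp: filterlim_at_bot_dense filterlim_at_top_dense)
  have ev3: "\<forall>\<^sub>F s in at_top. Re (\<Omega> s) = \<gamma>" by (rule \<gamma>)
  have ev4: "\<forall>\<^sub>F s in at_top. Re (\<Omega> (- s)) = \<gamma>"
    using \<gamma>(1) by (rule eventually_compose_filterlim[OF _ filterlim_uminus_at_bot_at_top])
  define g where "g = truncation \<Omega>"
  define loop where "loop s = g s +++ linepath (Complex \<gamma> (y2 s)) (Complex c (y2 s)) +++
      linepath (Complex c (y2 s)) (Complex c (y1 s)) +++ linepath (Complex c (y1 s)) (Complex \<gamma> (y1 s))" for s
  have g: "path (g s)" "valid_path (g s)" "path_image (g s) \<subseteq> range \<Omega>" for s
    unfolding g_def using valid_path_truncation[OF pC1] path_image_truncation_subset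
    by (auto intro: valid_path_imp_path)
  have ends: "\<forall>\<^sub>F s in at_top. pathstart (g s) = Complex \<gamma> (y1 s) \<and> pathfinish (g s) = Complex \<gamma> (y2 s)"
    using ev3 ev4 by eventually_elim (auto simp: g_def y1_def y2_def complex_eq_iff)
  have convex_Re: "convex {s. Re s \<ge> r}" "convex {s. Re s \<le> r}" for r
    using convex_halfspace_Re_ge convex_halfspace_Re_le by auto
  have gR: "- R0 \<le> Re w" "Re w \<le> R0" if w: "w \<in> path_image (g s)" for s w
  proof -
    obtain t where "w = \<Omega> t" using w g(3) by blast
    then show "- R0 \<le> Re w" "Re w \<le> R0" using R[of t] by (auto simp: R0_def)
  qed
  have windP: "\<forall>\<^sub>F s in at_top. winding_number (loop s) p = 0" if p: "p \<in> P" for p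
  proof -
    \<comment> \<open>The left poles extend arbitrarily far to the left, so there is one outside the
      half-plane Re s \<ge> -\<open>R0\<close> that contains the loop together with its
      detour.\<close>
    obtain p' where p': "p' \<in> P" "Re p' < - R0" using P(2) by blast
    obtain \<sigma> where \<sigma>: "path \<sigma>" "path_image \<sigma> \<subseteq> U" "pathstart \<sigma> = p" "pathfinish \<sigma> = p'"
      using pc(1) p p' U unfolding path_connected_def by blast
    obtain M where M: "M > 0" "\<And>s. s \<in> path_image \<sigma> \<Longrightarrow> norm s \<le> M"
      using bounded_path_image[OF \<sigma>(1)] by (auto simp: bounded_pos)
    show ?thesis
      using ends ev1[of M] ev2[of M]
    proof eventually_elim
      case (elim s)
      show ?case unfolding loop_def
      \<comment> \<open>The detour passes to the right of the disc of radius M that contains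
        \<sigma>. It is taken on the side away from the left poles so that p lies outside the
        half-plane K containing the auxiliary rectangle; heights beyond M keep the horizontal pieces
        off \<sigma>.\<close>
      proof (rule winding_number_closing_eq_0[where S = "path_image \<sigma>" and p' = p' and \<rho> = "M + 1 + R0" and
            H = "{s. Re s \<ge> - R0}" and K = "{s. Re s \<ge> c}"])
        show "p \<notin> path_image (g s)" using g(3)[of s] sub U(2) p by blast
        show "path_image \<sigma> \<inter> path_image (g s) = {}" using g(3)[of s] sub \<sigma> by blast
        show "y1 s < Im w \<and> Im w < y2 s \<and> Re w \<noteq> M + 1 + R0" if "w \<in> path_image \<sigma>" for w
          using M(2)[OF that] abs_Im_le_cmod[of w] abs_Re_le_cmod[of w] elim by (auto simp: R0_def)
        show "path_image (g s) \<subseteq> {s. - R0 \<le> Re s}" using gR by blast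
        show "connected (path_image \<sigma>)" using \<sigma> by (simp add: connected_path_image)
      qed (use elim M p p' P(1)[OF p] PQ(3) \<sigma> g convex_Re in \<open>auto simp: R0_def\<close>)
    qed
  qed
  have windQ: "\<forall>\<^sub>F s in at_top. winding_number (loop s) p = 0" if p: "p \<in> Q" for p
  proof -
    \<comment> \<open>The mirror image of the argument for left poles: the far pole is on the right
      and the detour on the left.\<close>
    obtain p' where p': "p' \<in> Q" "R0 < Re p'" using Q(2) by blast
    obtain \<sigma> where \<sigma>: "path \<sigma>" "path_image \<sigma> \<subseteq> V" "pathstart \<sigma> = p" "pathfinish \<sigma> = p'"
      using pc(2) p p' V unfolding path_connected_def by blast
    obtain M where M: "M > 0" "\<And>s. s \<in> path_image \<sigma> \<Longrightarrow> norm s \<le> M"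
      using bounded_path_image[OF \<sigma>(1)] by (auto simp: bounded_pos)
    show ?thesis
      using ends ev1[of M] ev2[of M]
    proof eventually_elim
      case (elim s)
      show ?case unfolding loop_def
      proof (rule winding_number_closing_eq_0[where S = "path_image \<sigma>" and p' = p' and \<rho> = "- (M + 1 + R0)" and
            H = "{s. Re s \<le> R0}" and K = "{s. Re s \<le> c}"])
        show "p \<notin> path_image (g s)" using g(3)[of s] sub V(2) p by blast
        show "path_image \<sigma> \<inter> path_image (g s) = {}" using g(3)[of s] sub \<sigma> by blast
        show "y1 s < Im w \<and> Im w < y2 s \<and> Re w \<noteq> - (M + 1 + R0)" if "w \<in> path_image \<sigma>" for w
          using M(2)[OF that] abs_Im_le_cmod[of w] abs_Re_le_cmod[of w] elim by (auto simp: R0_def)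
        show "path_image (g s) \<subseteq> {s. Re s \<le> R0}" using gR by blast
        show "connected (path_image \<sigma>)" using \<sigma> by (simp add: connected_path_image)
      qed (use elim M p p' Q(1)[OF p] PQ(3) \<sigma> g convex_Re in \<open>auto simp: R0_def\<close>)
    qed
  qed
  have img: "path_image (loop s) = path_image (g s) \<union> closed_segment (Complex \<gamma> (y2 s)) (Complex c (y2 s)) \<union>
       closed_segment (Complex c (y2 s)) (Complex c (y1 s)) \<union> closed_segment (Complex c (y1 s)) (Complex \<gamma> (y1 s))"
    if "pathfinish (g s) = Complex \<gamma> (y2 s)" for s
    using that by (simp add: loop_def path_image_join Un_assoc)
  \<comment> \<open>One half of a uniform statement: outside the strip a single convexity argument
    serves all points at once. Inside, the bound on s depends on the pole, and eventual statements
    can be combined only because the remaining poles are finite in number.\<close>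
  have windfar: "\<forall>\<^sub>F s in at_top. \<forall>p. \<bar>Re p\<bar> > R0 \<longrightarrow> winding_number (loop s) p = 0"
    using ends
  proof eventually_elim
    case (elim s)
    define H where "H = {s. Re s \<ge> - R0} \<inter> {s. Re s \<le> R0}"
    have H: "convex H" unfolding H_def by (intro convex_Int convex_Re)
    have mem: "Complex c y \<in> H" "Complex \<gamma> y \<in> H" for y by (auto simp: H_def R0_def)
    have "path_image (g s) \<subseteq> H" using gR by (auto simp: H_def)
    then have "path_image (loop s) \<subseteq> H"
      using img[of s] elim by (simp add: closed_segment_subset H mem)
    moreover have "path (loop s)" "pathfinish (loop s) = pathstart (loop s)"
      using elim g by (auto simp: loop_def)
    ultimately show ?case
      by (auto intro!: winding_number_zero_outside[OF _ H] simp: H_def)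
  qed
  have "\<forall>\<^sub>F s in at_top. \<forall>p \<in> {p \<in> P \<union> Q. \<bar>Re p\<bar> \<le> R0}. winding_number (loop s) p = 0"
    using windP windQ PQ(2) by (intro eventually_ball_finite) auto
  with windfar have wind: "\<forall>\<^sub>F s in at_top. \<forall>p \<in> P \<union> Q. winding_number (loop s) p = 0"
    by eventually_elim (metis (mono_tags, lifting) linorder_not_le mem_Collect_eq)
  have Fcont: "continuous_on S F" if "S \<inter> (P \<union> Q) = {}" for S
    using that by (intro continuous_on_subset[OF holomorphic_on_imp_continuous_on[OF F]]) auto
  have cmem: "Complex c y \<notin> P \<union> Q" for y using P(1)[of "Complex c y"] Q(1)[of "Complex c y"] by auto
  define Hz where "Hz y = contour_integral (linepath (Complex \<gamma> y) (Complex c y)) F" for y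
  define W where "W s = contour_integral (linepath (Complex c (y1 s)) (Complex c (y2 s))) F" for s
  have Hint: "F contour_integrable_on linepath (Complex a y) (Complex b y)" if "y \<noteq> 0" for a b y
    by (intro contour_integrable_continuous_linepath Fcont)
      (use PQ(3) that in \<open>auto simp: closed_segment_same_Im\<close>)
  have Vint: "F contour_integrable_on linepath (Complex c a) (Complex c b)" for a b
    by (intro contour_integrable_continuous_linepath Fcont)
      (use P(1) Q(1) in \<open>auto simp: closed_segment_same_Re\<close>)
  have rev: "contour_integral (linepath b a) F = - contour_integral (linepath a b) F" for a b
    using contour_integral_reversepath[of "linepath a b" F] by simp
  \<comment> \<open>Cauchy's theorem in its homology form on the closed loop: the truncated contour
    is traded for a segment of the line Re s = c and two horizontal pieces that vanish in the
    limit.\<close>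
  have key: "\<forall>\<^sub>F s in at_top. contour_integral (g s) F = W s - Hz (y2 s) + Hz (y1 s)"
    using wind ends ev1[of 0] ev2[of 0]
  proof eventually_elim
    case (elim s)
    have vp: "valid_path (loop s)" "pathfinish (loop s) = pathstart (loop s)"
      using elim g by (auto simp: loop_def)
    have "path_image (g s) \<subseteq> - (P \<union> Q)" using g(3)[of s] sub U V by blast
    moreover have "closed_segment (Complex c (y2 s)) (Complex c (y1 s)) \<subseteq> - (P \<union> Q)"
      using P(1) Q(1) by (auto simp: closed_segment_same_Re)
    moreover have "closed_segment (Complex a y) (Complex b y) \<subseteq> - (P \<union> Q)" if "y \<noteq> 0" for a b y
      using PQ(3) that by (auto simp: closed_segment_same_Im)
    ultimately have "path_image (loop s) \<subseteq> - (P \<union> Q)"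
      using img[of s] elim by (simp add: Un_subset_iff)
    then have *: "(F has_contour_integral 0) (loop s)"
      using elim vp by (intro Cauchy_theorem_global[OF open_Compl[OF PQ(1)] F]) auto
    then have "F contour_integrable_on loop s" by (rule has_contour_integral_integrable)
    then have gi: "F contour_integrable_on g s"
      using elim g by (auto simp: loop_def dest: contour_integrable_joinD1)
    have "0 = contour_integral (loop s) F" using contour_integral_unique[OF *] by simp
    also have "\<dots> = contour_integral (g s) F + (Hz (y2 s) +
        (contour_integral (linepath (Complex c (y2 s)) (Complex c (y1 s))) F +
         contour_integral (linepath (Complex c (y1 s)) (Complex \<gamma> (y1 s))) F))"
      unfolding loop_def Hz_def using elim g(2) gi Hint Vint by simp
    also have "\<dots> = contour_integral (g s) F + (Hz (y2 s) + (- W s + - Hz (y1 s)))"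
      unfolding rev[of "Complex c (y2 s)" "Complex c (y1 s)"] rev[of "Complex c (y1 s)" "Complex \<gamma> (y1 s)"]
      by (simp add: W_def Hz_def)
    finally show ?case by (simp add: algebra_simps)
  qed
  define f where "f t = F (\<Omega> t) * vector_derivative \<Omega> (at t)" for t
  have f_int: "(f has_integral I) UNIV" using I by (simp add: f_def[abs_def])
  have "((\<lambda>s. integral {- s..s} f) \<longlongrightarrow> I) at_top"
    by (rule integral_tendsto_has_integral_UNIV[OF f_int filterlim_uminus_at_bot_at_top filterlim_ident])
  moreover have "\<forall>\<^sub>F s in at_top. integral {- s..s} f = W s - Hz (y2 s) + Hz (y1 s)"
    using key eventually_gt_at_top[of 0]
  proof eventually_elim
    case (elim s)
    have "f integrable_on {- s..s}"
      using has_integral_integrable[OF f_int] by (rule integrable_on_subinterval) auto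
    then show ?case using contour_integral_truncation[OF pC1 \<open>s > 0\<close>, of F] elim
      by (simp add: g_def f_def[abs_def])
  qed
  ultimately have lim1: "((\<lambda>s. W s - Hz (y2 s) + Hz (y1 s)) \<longlongrightarrow> I) at_top"
    by (rule Lim_transform_eventually)
  obtain C where C: "\<And>s. - R0 \<le> Re s \<Longrightarrow> Re s \<le> R0 \<Longrightarrow> \<bar>Im s\<bar> \<ge> 1 \<Longrightarrow> norm (F s) \<le> C / (1 + (Im s)\<^sup>2)"
    using decay[of "- R0" R0] by auto
  have C': "norm (F s) \<le> C / (1 + (Im s)\<^sup>2)" if "Re s \<in> closed_segment \<gamma> c" "\<bar>Im s\<bar> \<ge> 1" for s
    using that by (intro C) (auto simp: closed_segment_eq_real_ivl R0_def split: if_splits)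
  have "((\<lambda>s. Hz (y2 s)) \<longlongrightarrow> 0) at_top"
    unfolding Hz_def
  proof (rule linepath_quadratic_decay_tendsto[OF _ C'])
    show "\<forall>\<^sub>F t in at_top. F contour_integrable_on linepath (Complex \<gamma> (y2 t)) (Complex c (y2 t))"
      using ev2[of 0] by eventually_elim (auto intro: Hint)
    show "filterlim (\<lambda>t. \<bar>y2 t\<bar>) at_top at_top"
      by (rule filterlim_compose[OF filterlim_abs_real y2])
  qed auto
  moreover have "((\<lambda>s. Hz (y1 s)) \<longlongrightarrow> 0) at_top"
    unfolding Hz_def
  proof (rule linepath_quadratic_decay_tendsto[OF _ C'])
    show "\<forall>\<^sub>F t in at_top. F contour_integrable_on linepath (Complex \<gamma> (y1 t)) (Complex c (y1 t))"
      using ev1[of 0] by eventually_elim (auto intro: Hint)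
    have "filterlim (\<lambda>t. - y1 t) at_top at_top" using y1 by (simp add: filterlim_uminus_at_top)
    then show "filterlim (\<lambda>t. \<bar>y1 t\<bar>) at_top at_top"
      by (rule filterlim_at_top_mono) (simp add: abs_ge_minus_self)
  qed auto
  moreover have "(W \<longlongrightarrow> \<i> * (LINT y|lborel. F (Complex c y))) at_top"
    unfolding W_def
  proof (rule vertical_line_tendsto[OF _ _ y1 y2])
    show "continuous_on UNIV (\<lambda>y. F (Complex c y))"
    proof (rule continuous_on_compose2[OF Fcont[of "range (Complex c)"]])
      show "continuous_on UNIV (Complex c)" unfolding Complex_eq by (intro continuous_intros)
    qed (use cmem in auto)
    show "norm (F (Complex c y)) \<le> C / (1 + y\<^sup>2)" if "\<bar>y\<bar> \<ge> 1" for y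
      using C[of "Complex c y"] that by (auto simp: R0_def)
  qed
  ultimately have "((\<lambda>s. W s - Hz (y2 s) + Hz (y1 s)) \<longlongrightarrow> \<i> * (LINT y|lborel. F (Complex c y)) - 0 + 0) at_top"
    by (intro tendsto_intros)
  then show ?thesis using tendsto_unique[OF trivial_limit_at_top_linorder lim1] by simp
qed

section \<open>The H-function as an integral along a vertical line\<close>

text \<open>All arguments of the gamma factors that produce poles are real affine functions of s.
  Allowing negative r treats the right poles, where r = -1/\<alpha>, together with the left
  ones.\<close>

lemma affine_nonpos_Ints_eq:
  fixes b r :: real
  assumes "r \<noteq> 0"
  shows "{s :: complex. of_real b + of_real r * s \<in> \<int>\<^sub>\<le>\<^sub>0} = range (\<lambda>k::nat. of_real (- (b + real k) / r))"
proof (intro set_eqI iffI; clarify)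
  fix s :: complex assume "of_real b + of_real r * s \<in> \<int>\<^sub>\<le>\<^sub>0"
  then obtain k :: nat where "of_real b + of_real r * s = - of_nat k" by (elim nonpos_Ints_cases')
  then have "s = of_real (- (b + real k) / r)" using assms by (simp add: field_simps) (metis add_diff_cancel_left' diff_minus_eq_add minus_diff_eq)
  then show "s \<in> range (\<lambda>k::nat. of_real (- (b + real k) / r))" by (rule range_eqI)
next
  fix k :: nat
  have "of_real b + of_real r * (of_real (- (b + real k) / r) :: complex) = - of_nat k"
    using assms by simp
  then show "of_real b + of_real r * (of_real (- (b + real k) / r) :: complex) \<in> \<int>\<^sub>\<le>\<^sub>0" by simp
qed

lemma closed_affine_nonpos_Ints:
  "closed {s :: complex. of_real b + of_real r * s \<in> \<int>\<^sub>\<le>\<^sub>0}"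
  using continuous_closed_vimage[OF closed_nonpos_Ints, of "\<lambda>s::complex. of_real b + of_real r * s"]
  by (simp add: vimage_def)

lemma finite_affine_nonpos_Ints:
  assumes "r \<noteq> 0"
  shows "finite {s :: complex. of_real b + of_real r * s \<in> \<int>\<^sub>\<le>\<^sub>0 \<and> \<bar>Re s\<bar> \<le> R}"
proof (rule finite_subset)
  have "finite {k::nat. real k \<le> X}" for X
    by (rule finite_subset[of _ "{..nat \<lfloor>X\<rfloor>}"]) (auto simp: le_nat_floor)
  then show "finite ((\<lambda>k::nat. complex_of_real (- (b + real k) / r)) ` {k. real k \<le> R * \<bar>r\<bar> + \<bar>b\<bar>})"
    by (rule finite_imageI)
  show "{s :: complex. of_real b + of_real r * s \<in> \<int>\<^sub>\<le>\<^sub>0 \<and> \<bar>Re s\<bar> \<le> R} \<subseteq>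
      (\<lambda>k::nat. complex_of_real (- (b + real k) / r)) ` {k. real k \<le> R * \<bar>r\<bar> + \<bar>b\<bar>}"
  proof clarify
    fix s :: complex assume s: "of_real b + of_real r * s \<in> \<int>\<^sub>\<le>\<^sub>0" "\<bar>Re s\<bar> \<le> R"
    then obtain k :: nat where k: "s = of_real (- (b + real k) / r)"
      using affine_nonpos_Ints_eq[OF assms, of b] by auto
    then have "\<bar>- (b + real k)\<bar> / \<bar>r\<bar> \<le> R" using s(2) by (simp only: Re_complex_of_real abs_divide)
    then have "\<bar>b + real k\<bar> / \<bar>r\<bar> \<le> R" by (simp only: abs_minus_cancel)
    then have "\<bar>b + real k\<bar> \<le> R * \<bar>r\<bar>" using assms by (simp add: divide_le_eq)
    then show "s \<in> (\<lambda>k::nat. complex_of_real (- (b + real k) / r)) ` {k. real k \<le> R * \<bar>r\<bar> + \<bar>b\<bar>}"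
      using k by auto
  qed
qed

section \<open>Location of the poles of the kernel\<close>

abbreviation diffusion_left_poles :: "real \<Rightarrow> complex set" where
  "diffusion_left_poles \<alpha> \<equiv> fox_left_poles 2 (diffusion_bs \<alpha>)"

abbreviation diffusion_right_poles :: "real \<Rightarrow> real \<Rightarrow> complex set" where
  "diffusion_right_poles \<alpha> \<beta> \<equiv> fox_right_poles 1 (diffusion_as \<alpha> \<beta>)"

lemma diffusion_left_poles_eq:
  "diffusion_left_poles \<alpha> = {s. of_real 1 + of_real 1 * s \<in> \<int>\<^sub>\<le>\<^sub>0} \<union> {s. of_real 1 + of_real (1 / \<alpha>) * s \<in> \<int>\<^sub>\<le>\<^sub>0}"
  by (auto simp: fox_left_poles_def numeral_2_eq_2 less_Suc_eq)

lemma diffusion_right_poles_eq: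
  "diffusion_right_poles \<alpha> \<beta> = {s. of_real 0 + of_real (- 1 / \<alpha>) * s \<in> \<int>\<^sub>\<le>\<^sub>0}"
  by (auto simp: fox_right_poles_def)

text \<open>The geometric conditions for independence of the contour. The gap between the two sets
  runs from -min 1 \<alpha> to 0 only: \<Gamma>(-s/\<alpha>) contributes the right pole 0, although
  the product is regular there.\<close>

lemma diffusion_poles:
  assumes "\<alpha> > 0"
  shows "closed (diffusion_left_poles \<alpha> \<union> diffusion_right_poles \<alpha> \<beta>)"
    and "finite {p \<in> diffusion_left_poles \<alpha> \<union> diffusion_right_poles \<alpha> \<beta>. \<bar>Re p\<bar> \<le> R}"
    and "p \<in> diffusion_left_poles \<alpha> \<union> diffusion_right_poles \<alpha> \<beta> \<Longrightarrow> Im p = 0"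
    and "p \<in> diffusion_left_poles \<alpha> \<Longrightarrow> Re p \<le> - min 1 \<alpha>"
    and "p \<in> diffusion_right_poles \<alpha> \<beta> \<Longrightarrow> 0 \<le> Re p"
    and "\<exists>p\<in>diffusion_left_poles \<alpha>. Re p < - R"
    and "\<exists>p\<in>diffusion_right_poles \<alpha> \<beta>. R < Re p"
proof -
  have nz: "1 \<noteq> (0::real)" "1 / \<alpha> \<noteq> 0" "- 1 / \<alpha> \<noteq> 0" using assms by auto
  show "closed (diffusion_left_poles \<alpha> \<union> diffusion_right_poles \<alpha> \<beta>)"
    unfolding diffusion_left_poles_eq diffusion_right_poles_eq
    by (intro closed_Un closed_affine_nonpos_Ints)
  have "{p \<in> diffusion_left_poles \<alpha> \<union> diffusion_right_poles \<alpha> \<beta>. \<bar>Re p\<bar> \<le> R} =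
      {s. of_real 1 + of_real 1 * s \<in> \<int>\<^sub>\<le>\<^sub>0 \<and> \<bar>Re s\<bar> \<le> R} \<union>
      {s. of_real 1 + of_real (1 / \<alpha>) * s \<in> \<int>\<^sub>\<le>\<^sub>0 \<and> \<bar>Re s\<bar> \<le> R} \<union>
      {s. of_real 0 + of_real (- 1 / \<alpha>) * s \<in> \<int>\<^sub>\<le>\<^sub>0 \<and> \<bar>Re s\<bar> \<le> R}"
    unfolding diffusion_left_poles_eq diffusion_right_poles_eq by blast
  then show "finite {p \<in> diffusion_left_poles \<alpha> \<union> diffusion_right_poles \<alpha> \<beta>. \<bar>Re p\<bar> \<le> R}"
    by (simp only: finite_Un finite_affine_nonpos_Ints nz not_False_eq_True simp_thms)
  note L = diffusion_left_poles_eq[of \<alpha>, unfolded affine_nonpos_Ints_eq[OF nz(1)] affine_nonpos_Ints_eq[OF nz(2)]]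
  note R = diffusion_right_poles_eq[of \<alpha> \<beta>, unfolded affine_nonpos_Ints_eq[OF nz(3)]]
  show "Im p = 0" if "p \<in> diffusion_left_poles \<alpha> \<union> diffusion_right_poles \<alpha> \<beta>"
    using that unfolding L R by auto
  show "Re p \<le> - min 1 \<alpha>" if p: "p \<in> diffusion_left_poles \<alpha>"
  proof -
    have "\<alpha> * 1 \<le> \<alpha> * (1 + real k)" for k :: nat using assms by (intro mult_left_mono) auto
    then have "- (\<alpha> * (1 + real k)) \<le> - min 1 \<alpha>" for k :: nat by (smt (verit))
    then show ?thesis using p unfolding L by (auto simp: algebra_simps min_def)
  qed
  show "0 \<le> Re p" if p: "p \<in> diffusion_right_poles \<alpha> \<beta>"
    using p assms unfolding R by auto
  obtain n :: nat where n: "R < real n" using reals_Archimedean2 by blast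
  have "complex_of_real (- (1 + real n) / 1) \<in> diffusion_left_poles \<alpha>" unfolding L by blast
  moreover have "Re (complex_of_real (- (1 + real n) / 1)) < - R" using n by simp
  ultimately show "\<exists>p\<in>diffusion_left_poles \<alpha>. Re p < - R" by blast
  obtain n :: nat where n: "R / \<alpha> < real n" using reals_Archimedean2 by blast
  have "complex_of_real (- (0 + real n) / (- 1 / \<alpha>)) \<in> diffusion_right_poles \<alpha> \<beta>" unfolding R by blast
  moreover have "R < Re (complex_of_real (- (0 + real n) / (- 1 / \<alpha>)))" using n assms by (simp add: field_simps)
  ultimately show "\<exists>p\<in>diffusion_right_poles \<alpha> \<beta>. R < Re p" by blast
qed

lemma fox_params_diffusion:
  assumes "\<alpha> > 0" "\<beta> > 0"
  shows "fox_params 2 1 (diffusion_as \<alpha> \<beta>) (diffusion_bs \<alpha>)"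
proof -
  have "False" if "p \<in> diffusion_left_poles \<alpha>" "p \<in> diffusion_right_poles \<alpha> \<beta>" for p
    using diffusion_poles(4)[OF assms(1) that(1)] diffusion_poles(5)[OF assms(1) that(2)] assms by (simp add: min_def split: if_splits)
  then show ?thesis using assms by (auto simp: fox_params_def)
qed

lemma diffusion_theta_holomorphic:
  assumes "\<alpha> > 0"
  shows "diffusion_theta \<alpha> \<beta> holomorphic_on - (diffusion_left_poles \<alpha> \<union> diffusion_right_poles \<alpha> \<beta>)"
proof -
  have *: "1 + s \<notin> \<int>\<^sub>\<le>\<^sub>0" "1 + s / of_real \<alpha> \<notin> \<int>\<^sub>\<le>\<^sub>0" "- (s / of_real \<alpha>) \<notin> \<int>\<^sub>\<le>\<^sub>0"
    if "s \<in> - (diffusion_left_poles \<alpha> \<union> diffusion_right_poles \<alpha> \<beta>)" for s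
    using that unfolding diffusion_left_poles_eq diffusion_right_poles_eq by auto
  show ?thesis
    unfolding diffusion_theta_eq[abs_def]
    by (intro holomorphic_intros; ((rule *, assumption) | (use assms in simp)))
qed

section \<open>The straight line as a separating contour\<close>

lemma L_vertical_line: "L_vertical (Complex c)"
proof -
  have eq: "Complex c = (\<lambda>t. of_real c + \<i> * of_real t)" by (auto simp: complex_eq_iff)
  have "(\<lambda>t. of_real c + \<i> * complex_of_real t) piecewise_C1_differentiable_on UNIV"
  proof (intro C1_differentiable_imp_piecewise)
    have "((\<lambda>t. of_real c + \<i> * complex_of_real t) has_vector_derivative \<i>) (at x)" for x
      by (auto intro!: derivative_eq_intros)
    then show "(\<lambda>t. of_real c + \<i> * complex_of_real t) C1_differentiable_on UNIV"
      unfolding C1_differentiable_on_def by (intro exI[of _ "\<lambda>_. \<i>"]) auto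
  qed
  then show ?thesis
    unfolding L_vertical_def simple_contour_def using eq
    by (auto simp: inj_def filterlim_ident)
qed

lemma vector_derivative_Complex: "vector_derivative (Complex c) (at t) = \<i>"
proof (rule vector_derivative_at)
  have eq: "Complex c = (\<lambda>t. of_real c + \<i> * of_real t)" by (auto simp: complex_eq_iff)
  show "(Complex c has_vector_derivative \<i>) (at t)"
    unfolding eq by (auto intro!: derivative_eq_intros)
qed

text \<open>The real parts of a connected set form an interval, so a connected set off the line
  cannot meet both sides. Hence the two open half-planes are maximal connected sets.\<close>

lemma separates_vertical_line:
  assumes "\<And>p. p \<in> P \<Longrightarrow> Re p < c" "\<And>q. q \<in> Q \<Longrightarrow> c < Re q"
  shows "separates (Complex c) P Q"
proof -
  have rng: "- range (Complex c) = {s. Re s \<noteq> c}"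
    by (force simp: complex_eq_iff image_iff)
  have side: "False" if "connected D" "u \<in> D" "v \<in> D" "Re u < c" "c < Re v" "D \<subseteq> {s. Re s \<noteq> c}" for D u v
  proof -
    have "connected (Re ` D)" by (intro connected_continuous_image continuous_intros that)
    then have "c \<in> Re ` D"
      by (rule connectedD_interval[where x = "Re u" and y = "Re v"]) (use that in auto)
    then show False using that by auto
  qed
  have "{s. Re s < c} \<in> components {s. Re s \<noteq> c}"
    unfolding in_components_maximal
  proof (intro conjI allI impI)
    show "{s. Re s < c} \<subseteq> {s. Re s \<noteq> c}" by auto
    show "connected {s. Re s < c}" by (simp add: convex_connected convex_halfspace_Re_lt)
    have "Complex (c - 1) 0 \<in> {s. Re s < c}" by simp
    then show "{s. Re s < c} \<noteq> {}" by blast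
    fix D assume D: "D \<noteq> {} \<and> {s. Re s < c} \<subseteq> D \<and> D \<subseteq> {s. Re s \<noteq> c} \<and> connected D"
    then have D': "{s. Re s < c} \<subseteq> D" "D \<subseteq> {s. Re s \<noteq> c}" "connected D" by blast+
    have m: "Complex (c - 1) 0 \<in> D" by (rule subsetD[OF D'(1)]) simp
    have "Re v < c" if v: "v \<in> D" for v
    proof -
      have "Re v \<noteq> c" using D'(2) v by blast
      moreover have "\<not> c < Re v"
        by (rule notI, rule side[OF D'(3) m v _ _ D'(2)]) simp_all
      ultimately show ?thesis by linarith
    qed
    then show "D = {s. Re s < c}" by (intro subset_antisym D'(1)) auto
  qed
  moreover have "{s. c < Re s} \<in> components {s. Re s \<noteq> c}"
    unfolding in_components_maximal
  proof (intro conjI allI impI)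
    show "{s. c < Re s} \<subseteq> {s. Re s \<noteq> c}" by auto
    show "connected {s. c < Re s}" by (simp add: convex_connected convex_halfspace_Re_gt)
    have "Complex (c + 1) 0 \<in> {s. c < Re s}" by simp
    then show "{s. c < Re s} \<noteq> {}" by blast
    fix D assume D: "D \<noteq> {} \<and> {s. c < Re s} \<subseteq> D \<and> D \<subseteq> {s. Re s \<noteq> c} \<and> connected D"
    then have D': "{s. c < Re s} \<subseteq> D" "D \<subseteq> {s. Re s \<noteq> c}" "connected D" by blast+
    have m: "Complex (c + 1) 0 \<in> D" by (rule subsetD[OF D'(1)]) simp
    have "c < Re v" if v: "v \<in> D" for v
    proof -
      have "Re v \<noteq> c" using D'(2) v by blast
      moreover have "\<not> Re v < c"
        by (rule notI, rule side[OF D'(3) v m _ _ D'(2)]) simp_all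
      ultimately show ?thesis by linarith
    qed
    then show "D = {s. c < Re s}" by (intro subset_antisym D'(1)) auto
  qed
  moreover have "{s. Re s < c} \<noteq> {s. c < Re s}"
  proof -
    have "Complex (c - 1) 0 \<in> {s. Re s < c}" "Complex (c - 1) 0 \<notin> {s. c < Re s}" by auto
    then show ?thesis by blast
  qed
  ultimately show ?thesis
    unfolding separates_def rng
    by (intro bexI[of _ "{s. Re s < c}"] bexI[of _ "{s. c < Re s}"] conjI subsetI) (simp_all add: assms)
qed

text \<open>The straight line shows that the vertical branch of \<open>fox_H\<close> is taken, and
  independence of the contour makes the described value unique. Since d\<xi> = i dy, the factor i in
  2\<pi>i cancels.\<close>

lemma fox_H_diffusion:
  assumes \<alpha>: "\<alpha> > 0" and \<beta>: "0 < \<beta>" "\<beta> < 2" and c: "- min 1 \<alpha> < c" "c < 0" and z: "z > 0"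
  shows "fox_H 2 1 (diffusion_as \<alpha> \<beta>) (diffusion_bs \<alpha>) (of_real z) =
    1 / (2 * of_real pi) * (LINT y|lborel. diffusion_theta \<alpha> \<beta> (Complex c y) * of_real z powr (- Complex c y))"
proof -
  define F where "F s = diffusion_theta \<alpha> \<beta> s * of_real z powr (- s)" for s
  define P Q where "P = diffusion_left_poles \<alpha>" and "Q = diffusion_right_poles \<alpha> \<beta>"
  have PQ: "Re p < c" if "p \<in> P" for p
    using diffusion_poles(4)[OF \<alpha>, of p] that c by (auto simp: P_def)
  have QP: "c < Re p" if "p \<in> Q" for p
    using diffusion_poles(5)[OF \<alpha>, of p \<beta>] that c by (auto simp: Q_def)
  have hol: "F holomorphic_on - (P \<union> Q)"
    unfolding F_def[abs_def] P_def Q_def using z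
    by (intro holomorphic_intros diffusion_theta_holomorphic[OF \<alpha>]) auto
  have decay: "\<exists>C. \<forall>s. A \<le> Re s \<and> Re s \<le> B \<and> \<bar>Im s\<bar> \<ge> 1 \<longrightarrow> norm (F s) \<le> C / (1 + (Im s)\<^sup>2)" for A B
  proof -
    obtain C where C: "C \<ge> 0" "\<And>s. A \<le> Re s \<Longrightarrow> Re s \<le> B \<Longrightarrow> \<bar>Im s\<bar> \<ge> 1 \<Longrightarrow>
        norm (diffusion_theta \<alpha> \<beta> s) \<le> C / (1 + (Im s)\<^sup>2)"
      using diffusion_theta_decay[OF \<alpha> \<beta>, of A B] by blast
    \<comment> \<open>For fixed z the modulus of z^(-s) is e^(-Re s ln z), which is bounded on the
      strip; thus the power does not spoil the decay of the kernel.\<close>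
    define K where "K = exp ((\<bar>A\<bar> + \<bar>B\<bar>) * \<bar>ln z\<bar>)"
    have "norm (F s) \<le> C * K / (1 + (Im s)\<^sup>2)" if s: "A \<le> Re s" "Re s \<le> B" "1 \<le> \<bar>Im s\<bar>" for s
    proof -
      have "- (Re s * ln z) \<le> \<bar>Re s\<bar> * \<bar>ln z\<bar>" by (metis abs_ge_minus_self abs_mult)
      also have "\<dots> \<le> (\<bar>A\<bar> + \<bar>B\<bar>) * \<bar>ln z\<bar>" using s by (intro mult_right_mono) auto
      finally have "norm (complex_of_real z powr (- s)) \<le> K"
        using z by (simp add: K_def norm_powr_real_powr powr_def Ln_of_real)
      then have "norm (F s) \<le> C / (1 + (Im s)\<^sup>2) * K"
        using C(2)[OF s] unfolding F_def norm_mult by (intro mult_mono) (auto intro: order_trans[OF norm_ge_zero])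
      then show ?thesis by simp
    qed
    then show ?thesis by blast
  qed
  have cont: "continuous_on UNIV (\<lambda>y. F (Complex c y))"
  proof (rule continuous_on_compose2[OF holomorphic_on_imp_continuous_on[OF hol]])
    show "continuous_on UNIV (Complex c)" unfolding Complex_eq by (intro continuous_intros)
    show "range (Complex c) \<subseteq> - (P \<union> Q)" using PQ QP by fastforce
  qed
  obtain C where C: "\<And>s. c \<le> Re s \<Longrightarrow> Re s \<le> c \<Longrightarrow> \<bar>Im s\<bar> \<ge> 1 \<Longrightarrow> norm (F s) \<le> C / (1 + (Im s)\<^sup>2)"
    using decay[of c c] by blast
  have "integrable lborel (\<lambda>y. F (Complex c y))"
    by (rule integrable_quadratic_decay[OF cont, of 1 C]) (metis C complex.sel order_refl)
  then have "((\<lambda>y. F (Complex c y) * \<i>) has_integral (LINT y|lborel. F (Complex c y)) * \<i>) UNIV"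
    by (intro has_integral_mult_left has_integral_integral_lborel)
  then have hi: "((\<lambda>y. F (Complex c y) * vector_derivative (Complex c) (at y)) has_integral
      (LINT y|lborel. F (Complex c y)) * \<i>) UNIV"
    by (simp add: vector_derivative_Complex)
  define v where "v = 1 / (2 * of_real pi * \<i>) * ((LINT y|lborel. F (Complex c y)) * \<i>)"
  have ex: "fox_H_along L_vertical 2 1 (diffusion_as \<alpha> \<beta>) (diffusion_bs \<alpha>) (of_real z) v"
    unfolding fox_H_along_def
  proof (intro conjI exI)
    show "fox_params 2 1 (diffusion_as \<alpha> \<beta>) (diffusion_bs \<alpha>)" using \<alpha> \<beta> by (intro fox_params_diffusion)
    show "L_vertical (Complex c)" by (rule L_vertical_line)
    show "separates (Complex c) (diffusion_left_poles \<alpha>) (diffusion_right_poles \<alpha> \<beta>)"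
      using PQ QP by (intro separates_vertical_line) (auto simp: P_def Q_def)
    show "((\<lambda>t. diffusion_theta \<alpha> \<beta> (Complex c t) * of_real z powr (- Complex c t) * vector_derivative (Complex c) (at t))
        has_integral (LINT y|lborel. F (Complex c y)) * \<i>) UNIV"
      using hi by (simp add: F_def)
  qed (simp add: v_def)
  have uniq: "v' = v" if v'_along: "fox_H_along L_vertical 2 1 (diffusion_as \<alpha> \<beta>) (diffusion_bs \<alpha>) (of_real z) v'"
    for v'
  proof -
    obtain \<Omega> I where \<Omega>: "L_vertical \<Omega>" "separates \<Omega> P Q"
      "((\<lambda>t. F (\<Omega> t) * vector_derivative \<Omega> (at t)) has_integral I) UNIV" and v': "v' = 1 / (2 * of_real pi * \<i>) * I"
      using v'_along unfolding fox_H_along_def P_def Q_def F_def by blast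
    have "I = \<i> * (LINT y|lborel. F (Complex c y))"
    proof (rule vertical_contour_integral_eq[OF \<Omega>(1,2) _ _ _ PQ _ QP _ hol decay \<Omega>(3)])
      show "closed (P \<union> Q)" "finite {p \<in> P \<union> Q. \<bar>Re p\<bar> \<le> R}" "\<exists>p\<in>P. Re p < - R" "\<exists>q\<in>Q. R < Re q" for R
        unfolding P_def Q_def by (rule diffusion_poles[OF \<alpha>])+
      show "Im p = 0" if "p \<in> P \<union> Q" for p
        using that unfolding P_def Q_def by (rule diffusion_poles(3)[OF \<alpha>])
    qed
    then show ?thesis by (simp add: v' v_def)
  qed
  have "fox_H 2 1 (diffusion_as \<alpha> \<beta>) (diffusion_bs \<alpha>) (of_real z) =
     (THE v. fox_H_along L_vertical 2 1 (diffusion_as \<alpha> \<beta>) (diffusion_bs \<alpha>) (of_real z) v)"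
    using ex unfolding fox_H_def by auto
  also have "\<dots> = v" using ex uniq by (rule the_equality)
  finally show ?thesis by (simp add: v_def F_def)
qed

section \<open>Mellin inversion\<close>

lemma of_real_powr_exp:
  assumes "z > 0"
  shows "of_real z powr (w :: complex) = exp (w * of_real (ln z))"
  using assms by (simp add: powr_def Ln_of_real)

lemma norm_exp_mult_ln: "norm (exp (w * complex_of_real (ln z))) = exp (Re w * ln z)"
  by simp

lemma powr_tendsto_0_at_right:
  assumes "Re w > 0"
  shows "((\<lambda>z. exp (w * complex_of_real (ln z))) \<longlongrightarrow> 0) (at_right 0)"
proof (rule tendsto_norm_zero_cancel)
  have "filterlim (\<lambda>z. Re w * ln z) at_bot (at_right 0)"
    using assms by (intro filterlim_tendsto_pos_mult_at_bot[OF tendsto_const] ln_at_0)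
  then have "((\<lambda>z. exp (Re w * ln z)) \<longlongrightarrow> 0) (at_right 0)"
    by (rule filterlim_compose[OF exp_at_bot])
  then show "((\<lambda>z. norm (exp (w * complex_of_real (ln z)))) \<longlongrightarrow> 0) (at_right 0)"
    unfolding norm_exp_mult_ln .
qed

lemma powr_tendsto_0_at_top:
  assumes "Re w < 0"
  shows "((\<lambda>z. exp (w * complex_of_real (ln z))) \<longlongrightarrow> 0) at_top"
proof (rule tendsto_norm_zero_cancel)
  have "filterlim (\<lambda>z. Re w * ln z) at_bot at_top"
    using assms by (intro filterlim_tendsto_neg_mult_at_bot[OF tendsto_const] ln_at_top)
  then have "((\<lambda>z. exp (Re w * ln z)) \<longlongrightarrow> 0) at_top"
    by (rule filterlim_compose[OF exp_at_bot])
  then show "((\<lambda>z. norm (exp (w * complex_of_real (ln z)))) \<longlongrightarrow> 0) at_top"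
    unfolding norm_exp_mult_ln .
qed

lemma has_vector_derivative_powr:
  assumes "z > 0" "w \<noteq> 0"
  shows "((\<lambda>z. exp (w * complex_of_real (ln z)) / w) has_vector_derivative exp ((w - 1) * of_real (ln z))) (at z)"
proof -
  have "((\<lambda>z. complex_of_real (ln z)) has_vector_derivative of_real (1 / z)) (at z)"
    using assms by (intro has_vector_derivative_of_real) (auto intro!: derivative_eq_intros)
  then have "((\<lambda>z. w * complex_of_real (ln z)) has_vector_derivative w * of_real (1 / z)) (at z)"
    by (intro has_vector_derivative_mult_right)
  then have "((exp \<circ> (\<lambda>z. w * complex_of_real (ln z))) has_vector_derivative (w * of_real (1 / z)) * exp (w * of_real (ln z))) (at z)"
    by (intro field_vector_diff_chain_at DERIV_exp)
  then have "((\<lambda>z. exp (w * complex_of_real (ln z)) / w) has_vector_derivative (w * of_real (1 / z)) * exp (w * of_real (ln z)) / w) (at z)"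
    unfolding o_def by (rule has_vector_derivative_divide)
  moreover have "(w * of_real (1 / z)) * exp (w * of_real (ln z)) / w = exp ((w - 1) * of_real (ln z))"
  proof -
    have "exp (complex_of_real (ln z)) = of_real z" using assms by (simp add: exp_of_real)
    then show ?thesis using assms by (simp add: left_diff_distrib exp_diff)
  qed
  ultimately show ?thesis by simp
qed

text \<open>The fundamental theorem for nonnegative integrands first gives integrability of the
  modulus, a real power. With this domination the version for complex integrands yields the value
  from the primitive z^w / w, which vanishes at 0.\<close>

lemma powr_integral_unit_interval:
  assumes w: "Re w > 0"
  shows "set_integrable lborel {0<..<1} (\<lambda>z. exp ((w - 1) * complex_of_real (ln z)))" (is ?A)
    and "(LINT z:{0<..<1}|lborel. exp ((w - 1) * complex_of_real (ln z))) = 1 / w" (is ?B)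
proof -
  have e: "einterval 0 1 = {0<..<1::real}"
    by (simp add: einterval_def zero_ereal_def one_ereal_def greaterThanLessThan_def greaterThan_def lessThan_def Collect_conj_eq)
  have r: "set_integrable lborel {0<..<1} (\<lambda>z::real. exp ((Re w - 1) * ln z))"
  proof -
    have "set_integrable lborel (einterval 0 1) (\<lambda>z::real. exp ((Re w - 1) * ln z))"
    proof (rule interval_integral_FTC_nonneg(1)[where F = "\<lambda>z. exp (Re w * ln z) / Re w" and A = 0 and B = "1 / Re w"])
      fix z :: real assume z: "0 < ereal z" "ereal z < 1"
      then have z0: "z > 0" by (simp add: zero_ereal_def)
      show "DERIV (\<lambda>z. exp (Re w * ln z) / Re w) z :> exp ((Re w - 1) * ln z)"
        using z0 w by (auto intro!: derivative_eq_intros simp: left_diff_distrib exp_diff)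
      show "isCont (\<lambda>z. exp ((Re w - 1) * ln z)) z"
        using z0 by (intro continuous_intros) auto
    next
      show "(((\<lambda>z. exp (Re w * ln z) / Re w) \<circ> real_of_ereal) \<longlongrightarrow> 0) (at_right 0)"
        unfolding zero_ereal_def ereal_tendsto_simps
        using tendsto_divide_zero[OF tendsto_norm_zero[OF powr_tendsto_0_at_right[OF w]], of "Re w"]
        by (simp add: o_def)
      have "((\<lambda>z. exp (Re w * ln z) / Re w) \<longlongrightarrow> exp (Re w * ln 1) / Re w) (at_left 1)"
        using w by (intro tendsto_intros) auto
      then show "(((\<lambda>z. exp (Re w * ln z) / Re w) \<circ> real_of_ereal) \<longlongrightarrow> 1 / Re w) (at_left 1)"
        unfolding one_ereal_def ereal_tendsto_simps by simp
    qed auto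
    then show ?thesis unfolding e .
  qed
  show ?A
  proof (rule set_integrable_bound[OF r])
    show "set_borel_measurable lborel {0<..<1} (\<lambda>z. exp ((w - 1) * complex_of_real (ln z)))"
      unfolding set_borel_measurable_def by measurable
  qed (auto intro!: AE_I2)
  have "(LBINT z=0..1. exp ((w - 1) * complex_of_real (ln z))) = 1 / w - 0"
  proof (rule interval_integral_FTC_integrable[where F = "\<lambda>z. exp (w * complex_of_real (ln z)) / w"])
    fix z :: real assume z: "0 < ereal z" "ereal z < 1"
    then have z0: "z > 0" by (simp add: zero_ereal_def)
    show "((\<lambda>z. exp (w * complex_of_real (ln z)) / w) has_vector_derivative exp ((w - 1) * of_real (ln z))) (at z)"
      using z0 w by (intro has_vector_derivative_powr) auto
    show "isCont (\<lambda>z. exp ((w - 1) * complex_of_real (ln z))) z"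
      using z0 by (intro continuous_intros) auto
  next
    show "(((\<lambda>z. exp (w * complex_of_real (ln z)) / w) \<circ> real_of_ereal) \<longlongrightarrow> 0) (at_right 0)"
      unfolding zero_ereal_def ereal_tendsto_simps
      using tendsto_divide_zero[OF powr_tendsto_0_at_right[OF w], of w] by (simp add: o_def)
    have "((\<lambda>z. exp (w * complex_of_real (ln z)) / w) \<longlongrightarrow> exp (w * of_real (ln 1)) / w) (at_left 1)"
      using w by (intro tendsto_intros) auto
    then show "(((\<lambda>z. exp (w * complex_of_real (ln z)) / w) \<circ> real_of_ereal) \<longlongrightarrow> 1 / w) (at_left 1)"
      unfolding one_ereal_def ereal_tendsto_simps by simp
  qed (use \<open>?A\<close> e in auto)
  then show ?B by (simp add: interval_lebesgue_integral_def e)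
qed

lemma powr_integral_at_top:
  assumes w: "Re w < 0"
  shows "set_integrable lborel {1<..} (\<lambda>z. exp ((w - 1) * complex_of_real (ln z)))" (is ?A)
    and "(LINT z:{1<..}|lborel. exp ((w - 1) * complex_of_real (ln z))) = - 1 / w" (is ?B)
proof -
  have e: "einterval 1 \<infinity> = {1::real<..}"
    by (simp add: einterval_def one_ereal_def greaterThan_def)
  have r: "set_integrable lborel {1<..} (\<lambda>z::real. exp ((Re w - 1) * ln z))"
  proof -
    have "set_integrable lborel (einterval 1 \<infinity>) (\<lambda>z::real. exp ((Re w - 1) * ln z))"
    proof (rule interval_integral_FTC_nonneg(1)[where F = "\<lambda>z. exp (Re w * ln z) / Re w" and A = "1 / Re w" and B = 0])
      fix z :: real assume z: "1 < ereal z" "ereal z < \<infinity>"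
      then have z0: "z > 0" by (simp add: one_ereal_def)
      show "DERIV (\<lambda>z. exp (Re w * ln z) / Re w) z :> exp ((Re w - 1) * ln z)"
        using z0 w by (auto intro!: derivative_eq_intros simp: left_diff_distrib exp_diff)
      show "isCont (\<lambda>z. exp ((Re w - 1) * ln z)) z"
        using z0 by (intro continuous_intros) auto
    next
      show "(((\<lambda>z. exp (Re w * ln z) / Re w) \<circ> real_of_ereal) \<longlongrightarrow> 0) (at_left \<infinity>)"
        unfolding ereal_tendsto_simps
        using tendsto_divide_zero[OF tendsto_norm_zero[OF powr_tendsto_0_at_top[OF w]], of "Re w"]
        by (simp add: o_def)
      have "((\<lambda>z. exp (Re w * ln z) / Re w) \<longlongrightarrow> exp (Re w * ln 1) / Re w) (at_right 1)"
        using w by (intro tendsto_intros) auto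
      then show "(((\<lambda>z. exp (Re w * ln z) / Re w) \<circ> real_of_ereal) \<longlongrightarrow> 1 / Re w) (at_right 1)"
        unfolding one_ereal_def ereal_tendsto_simps by simp
    qed auto
    then show ?thesis unfolding e .
  qed
  show ?A
  proof (rule set_integrable_bound[OF r])
    show "set_borel_measurable lborel {1<..} (\<lambda>z. exp ((w - 1) * complex_of_real (ln z)))"
      unfolding set_borel_measurable_def by measurable
  qed (auto intro!: AE_I2)
  have "(LBINT z=1..\<infinity>. exp ((w - 1) * complex_of_real (ln z))) = 0 - 1 / w"
  proof (rule interval_integral_FTC_integrable[where F = "\<lambda>z. exp (w * complex_of_real (ln z)) / w"])
    fix z :: real assume z: "1 < ereal z" "ereal z < \<infinity>"
    then have z0: "z > 0" by (simp add: one_ereal_def)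
    show "((\<lambda>z. exp (w * complex_of_real (ln z)) / w) has_vector_derivative exp ((w - 1) * of_real (ln z))) (at z)"
      using z0 w by (intro has_vector_derivative_powr) auto
    show "isCont (\<lambda>z. exp ((w - 1) * complex_of_real (ln z))) z"
      using z0 by (intro continuous_intros) auto
  next
    show "(((\<lambda>z. exp (w * complex_of_real (ln z)) / w) \<circ> real_of_ereal) \<longlongrightarrow> 0) (at_left \<infinity>)"
      unfolding ereal_tendsto_simps
      using tendsto_divide_zero[OF powr_tendsto_0_at_top[OF w], of w] by (simp add: o_def)
    have "((\<lambda>z. exp (w * complex_of_real (ln z)) / w) \<longlongrightarrow> exp (w * of_real (ln 1)) / w) (at_right 1)"
      using w by (intro tendsto_intros) auto
    then show "(((\<lambda>z. exp (w * complex_of_real (ln z)) / w) \<circ> real_of_ereal) \<longlongrightarrow> 1 / w) (at_right 1)"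
      unfolding one_ereal_def ereal_tendsto_simps by simp
  qed (use \<open>?A\<close> e in auto)
  then show ?B by (simp add: interval_lebesgue_integral_def e)
qed

text \<open>S is meant to be (0,1) or (1,\<infinity>), and k the resulting kernel
  \<plusminus>1/(\<delta> - s) on the line s = c + iy.\<close>

lemma mellin_half_Fubini:
  fixes h k :: "real \<Rightarrow> complex"
  assumes S: "S \<in> sets lborel" and h: "integrable lborel h"
    and pow: "\<And>y. set_integrable lborel S (\<lambda>z. exp ((\<delta> - Complex c y - 1) * complex_of_real (ln z)))"
    and k: "\<And>y. (LINT z:S|lborel. exp ((\<delta> - Complex c y - 1) * complex_of_real (ln z))) = k y"
  shows "set_integrable lborel S (\<lambda>z. exp ((\<delta> - 1) * complex_of_real (ln z)) *
            (LINT y|lborel. h y * exp (- Complex c y * complex_of_real (ln z))))" (is ?A)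
    and "(LINT z:S|lborel. exp ((\<delta> - 1) * complex_of_real (ln z)) *
            (LINT y|lborel. h y * exp (- Complex c y * complex_of_real (ln z)))) = (LINT y|lborel. h y * k y)" (is ?B)
proof -
  define E where "E y z = h y * (indicat_real S z *\<^sub>R exp ((\<delta> - Complex c y - 1) * complex_of_real (ln z)))" for y z :: real
  have [measurable]: "h \<in> borel_measurable borel" using h by auto
  have [measurable]: "S \<in> sets borel" using S by simp
  have [measurable]: "Complex c \<in> borel_measurable borel"
    unfolding Complex_eq[abs_def] by measurable
  have [measurable]: "case_prod E \<in> borel_measurable (lborel \<Otimes>\<^sub>M lborel)"
    unfolding E_def by measurable
  \<comment> \<open>The modulus of the power depends on Re s = c but not on y. Absolute
    integrability over the product therefore factors into that of h and that of one real
    power.\<close>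
  have nE: "norm (E y z) = norm (h y) * (indicat_real S z *\<^sub>R exp ((Re \<delta> - c - 1) * ln z))" for y z
    by (simp add: E_def norm_mult indicator_def)
  have int: "integrable (lborel \<Otimes>\<^sub>M lborel) (case_prod E)"
  proof (rule lborel_pair.Fubini_integrable)
    show "case_prod E \<in> borel_measurable (lborel \<Otimes>\<^sub>M lborel)" by measurable
    show "integrable lborel (\<lambda>y. LINT z|lborel. norm (case_prod E (y, z)))"
      using h by (simp add: nE)
    show "AE y in lborel. integrable lborel (\<lambda>z. case_prod E (y, z))"
      using pow unfolding E_def set_integrable_def split by (intro AE_I2 integrable_mult_right)
  qed
  have fst: "(LINT y|lborel. E y z) = indicat_real S z *\<^sub>R (exp ((\<delta> - 1) * complex_of_real (ln z)) *
            (LINT y|lborel. h y * exp (- Complex c y * complex_of_real (ln z))))" for z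
  proof -
    have "E y z = (indicat_real S z *\<^sub>R exp ((\<delta> - 1) * complex_of_real (ln z))) * (h y * exp (- Complex c y * complex_of_real (ln z)))" for y
    proof -
      have "exp ((\<delta> - Complex c y - 1) * complex_of_real (ln z)) =
          exp ((\<delta> - 1) * complex_of_real (ln z)) * exp (- Complex c y * complex_of_real (ln z))"
        by (simp add: algebra_simps flip: exp_add)
      then show ?thesis by (simp add: E_def mult_ac)
    qed
    then show ?thesis by simp
  qed
  have snd: "(LINT z|lborel. E y z) = h y * k y" for y
    using k[of y] by (simp only: E_def set_lebesgue_integral_def integral_mult_right_zero)
  show ?A using lborel_pair.integrable_snd[OF int] unfolding fst set_integrable_def .
  show ?B using lborel_pair.Fubini_integral[OF int] unfolding fst snd set_lebesgue_integral_def .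
qed

text \<open>Stated for an arbitrary holomorphic g of quadratic decay because it serves two different
  continuations of the kernel, on strips of different width.\<close>

lemma mellin_inversion:
  fixes g :: "complex \<Rightarrow> complex" and H :: "real \<Rightarrow> complex"
  assumes hol: "g holomorphic_on {s. a < Re s \<and> Re s < b}"
    and decay: "\<And>A B. a < A \<Longrightarrow> B < b \<Longrightarrow>
      \<exists>C. \<forall>s. A \<le> Re s \<and> Re s \<le> B \<and> \<bar>Im s\<bar> \<ge> 1 \<longrightarrow> norm (g s) \<le> C / (1 + (Im s)\<^sup>2)"
    and c: "a < c" "c < b"
    and H: "\<And>z. z > 0 \<Longrightarrow> H z = 1 / (2 * of_real pi) *
      (LINT y|lborel. g (Complex c y) * exp (- Complex c y * of_real (ln z)))"
    and \<delta>: "a < Re \<delta>" "Re \<delta> < b"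
  shows "set_integrable lborel {0<..} (\<lambda>z. exp ((\<delta> - 1) * of_real (ln z)) * H z)" (is ?A)
    and "(LINT z:{0<..}|lborel. exp ((\<delta> - 1) * of_real (ln z)) * H z) = g \<delta>" (is ?B)
proof -
  define St where "St = {s. a < Re s \<and> Re s < b}"
  have St_eq: "St = {s. Re s > a} \<inter> {s. Re s < b}" by (auto simp: St_def)
  have St: "open St" "convex St"
    unfolding St_eq by (intro open_Int open_halfspace_Re_gt open_halfspace_Re_lt,
      intro convex_Int convex_halfspace_Re_gt convex_halfspace_Re_lt)
  have hol: "g holomorphic_on St" using hol by (simp add: St_def)
  have line: "continuous_on UNIV (Complex x)" for x
    unfolding Complex_eq by (intro continuous_intros)
  have contl: "continuous_on UNIV (\<lambda>y. f (Complex x y))" if "continuous_on T f" "range (Complex x) \<subseteq> T" for f x and T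
    using that by (intro continuous_on_compose2[OF that(1) line]) auto
  have contg: "continuous_on UNIV (\<lambda>y. g (Complex x y))" if "a < x" "x < b" for x
    using that by (intro contl[OF holomorphic_on_imp_continuous_on[OF hol]]) (auto simp: St_def)
  have rectsub: "path_image (rectpath (Complex c1 (- T)) (Complex c2 T)) \<subseteq> St"
    if "a < c1" "c1 < c2" "c2 < b" "T \<ge> 0" for c1 c2 T
  proof -
    have "path_image (rectpath (Complex c1 (- T)) (Complex c2 T)) \<subseteq> cbox (Complex c1 (- T)) (Complex c2 T)"
      using that by (intro path_image_rectpath_subset_cbox) auto
    also have "\<dots> \<subseteq> St" using that by (auto simp: St_def in_cbox_complex_iff)
    finally show ?thesis .
  qed
  have shift: "(LINT y|lborel. g (Complex c1 y) * exp (- Complex c1 y * of_real (ln z))) =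
      (LINT y|lborel. g (Complex c2 y) * exp (- Complex c2 y * of_real (ln z)))"
    if cc: "a < c1" "c1 < c2" "c2 < b" for c1 c2 z
  proof -
    define F where "F s = g s * exp (- s * of_real (ln z))" for s
    have holF: "F holomorphic_on St" unfolding F_def by (intro holomorphic_intros hol)
    obtain C where C: "\<And>s. c1 \<le> Re s \<Longrightarrow> Re s \<le> c2 \<Longrightarrow> \<bar>Im s\<bar> \<ge> 1 \<Longrightarrow> norm (g s) \<le> C / (1 + (Im s)\<^sup>2)"
      using decay[of c1 c2] cc by auto
    define K where "K = exp ((\<bar>c1\<bar> + \<bar>c2\<bar>) * \<bar>ln z\<bar>)"
    have "\<i> * ((LINT y|lborel. F (Complex c2 y)) - (LINT y|lborel. F (Complex c1 y))) = 0"
    proof (rule strip_contour_shift[OF cc(2), where Y = 1 and C = "C * K"])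
      show "continuous_on UNIV (\<lambda>y. F (Complex x y))" if "x \<in> {c1, c2}" for x
        using that cc by (intro contl[OF holomorphic_on_imp_continuous_on[OF holF]]) (auto simp: St_def)
      show "(F has_contour_integral 0) (rectpath (Complex c1 (- T)) (Complex c2 T))" if "T \<ge> 1" for T
        using that cc rectsub[of c1 c2 T] by (intro Cauchy_theorem_convex_simple[OF holF St(2)]) auto
      fix s assume s: "c1 \<le> Re s" "Re s \<le> c2" "1 \<le> \<bar>Im s\<bar>"
      have "- (Re s * ln z) \<le> \<bar>Re s\<bar> * \<bar>ln z\<bar>" by (metis abs_ge_minus_self abs_mult)
      also have "\<dots> \<le> (\<bar>c1\<bar> + \<bar>c2\<bar>) * \<bar>ln z\<bar>" using s by (intro mult_right_mono) auto
      finally have "norm (exp (- s * of_real (ln z))) \<le> K" by (simp add: K_def)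
      then have "norm (F s) \<le> C / (1 + (Im s)\<^sup>2) * K"
        using C[OF s] unfolding F_def norm_mult by (intro mult_mono) (auto intro: order_trans[OF norm_ge_zero])
      then show "norm (F s) \<le> C * K / (1 + (Im s)\<^sup>2)" by simp
    qed
    then show ?thesis by (simp add: F_def)
  qed
  have Heq: "H z = 1 / (2 * of_real pi) * (LINT y|lborel. g (Complex x y) * exp (- Complex x y * of_real (ln z)))"
    if "z > 0" "a < x" "x < b" for x z
    using shift[of x c z] shift[of c x z] H[of z] that c by (cases x c rule: linorder_cases) auto
  \<comment> \<open>The power z^(\<delta> - s - 1) is integrable at 0 exactly when Re s < Re
    \<delta>, and at \<infinity> exactly when Re s > Re \<delta>; this dictates the two
    lines.\<close>
  obtain c1 where c1: "a < c1" "c1 < Re \<delta>" using dense \<delta> by blast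
  obtain c2 where c2: "Re \<delta> < c2" "c2 < b" using dense \<delta> by blast
  have intg: "integrable lborel (\<lambda>y. g (Complex x y))" if x: "a < x" "x < b" for x
  proof -
    obtain C where "\<And>s. x \<le> Re s \<Longrightarrow> Re s \<le> x \<Longrightarrow> \<bar>Im s\<bar> \<ge> 1 \<Longrightarrow> norm (g s) \<le> C / (1 + (Im s)\<^sup>2)"
      using decay[of x x] x by auto
    then show ?thesis
      by (intro integrable_quadratic_decay[OF contg[OF x], of 1 C]) (metis complex.sel order_refl)
  qed
  define h where "h z x = exp ((\<delta> - 1) * complex_of_real (ln z)) *
     (LINT y|lborel. g (Complex x y) * exp (- Complex x y * of_real (ln z)))" for z x
  have hH: "exp ((\<delta> - 1) * of_real (ln z)) * H z = 1 / (2 * of_real pi) * h z x" if "z > 0" "a < x" "x < b" for x z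
    using Heq[OF that] by (simp add: h_def)
  have lo: "set_integrable lborel {0<..<1} (\<lambda>z. h z c1)"
     "(LINT z:{0<..<1}|lborel. h z c1) = (LINT y|lborel. g (Complex c1 y) * (1 / (\<delta> - Complex c1 y)))"
    unfolding h_def using c1 c2
    by (intro mellin_half_Fubini intg powr_integral_unit_interval; simp)+
  have hi: "set_integrable lborel {1<..} (\<lambda>z. h z c2)"
     "(LINT z:{1<..}|lborel. h z c2) = (LINT y|lborel. g (Complex c2 y) * (- 1 / (\<delta> - Complex c2 y)))"
    unfolding h_def using c1 c2
    by (intro mellin_half_Fubini intg powr_integral_at_top; simp)+
  define f where "f z = exp ((\<delta> - 1) * of_real (ln z)) * H z" for z
  have lo_f: "set_integrable lborel {0<..<1} f"
    "(LINT z:{0<..<1}|lborel. f z) = 1 / (2 * of_real pi) * (LINT z:{0<..<1}|lborel. h z c1)"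
  proof -
    have eq: "f z = 1 / (2 * of_real pi) * h z c1" if "z \<in> {0<..<1}" for z
      unfolding f_def using that c1 c2 by (intro hH) auto
    have "set_integrable lborel {0<..<1} (\<lambda>z. 1 / (2 * of_real pi) * h z c1)"
      using lo(1) by (intro set_integrable_mult_right)
    also have "?this \<longleftrightarrow> set_integrable lborel {0<..<1} f"
      using eq by (intro set_integrable_cong) simp_all
    finally show "set_integrable lborel {0<..<1} f" .
    show "(LINT z:{0<..<1}|lborel. f z) = 1 / (2 * of_real pi) * (LINT z:{0<..<1}|lborel. h z c1)"
      unfolding set_integral_mult_right[symmetric] using eq by (intro set_lebesgue_integral_cong) auto
  qed
  have hi_f: "set_integrable lborel {1<..} f"
    "(LINT z:{1<..}|lborel. f z) = 1 / (2 * of_real pi) * (LINT z:{1<..}|lborel. h z c2)"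
  proof -
    have eq: "f z = 1 / (2 * of_real pi) * h z c2" if "z \<in> {1<..}" for z
      unfolding f_def using that c1 c2 by (intro hH) auto
    have "set_integrable lborel {1<..} (\<lambda>z. 1 / (2 * of_real pi) * h z c2)"
      using hi(1) by (intro set_integrable_mult_right)
    also have "?this \<longleftrightarrow> set_integrable lborel {1<..} f"
      using eq by (intro set_integrable_cong) simp_all
    finally show "set_integrable lborel {1<..} f" .
    show "(LINT z:{1<..}|lborel. f z) = 1 / (2 * of_real pi) * (LINT z:{1<..}|lborel. h z c2)"
      unfolding set_integral_mult_right[symmetric] using eq by (intro set_lebesgue_integral_cong) auto
  qed
  have pt1: "(\<lambda>z. indicat_real {1} z *\<^sub>R f z) = (\<lambda>z. indicat_real {1} z *\<^sub>R f 1)"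
    by (auto simp: indicator_def)
  have pt: "set_integrable lborel {1} f" "(LINT z:{1}|lborel. f z) = 0"
    unfolding set_integrable_def set_lebesgue_integral_def pt1 by auto
  have un: "{0<..} = ({0<..<1} \<union> {1}) \<union> {1::real<..}" by auto
  have int01: "set_integrable lborel ({0<..<1} \<union> {1}) f"
    by (intro set_integrable_Un lo_f pt) auto
  show ?A unfolding f_def[symmetric] un
    by (intro set_integrable_Un int01 hi_f) auto
  \<comment> \<open>Over (0,1) the kernel 1/(\<delta> - s) gives -G, over (1,\<infinity>) the kernel
    -1/(\<delta> - s) gives G. Their sum is the difference of two line integrals of a function with
    residue g(\<delta>) at \<delta>.\<close>
  define G where "G s = g s / (s - \<delta>)" for s
  have "(LINT z:{0<..}|lborel. f z) = (LINT z:{0<..<1} \<union> {1}|lborel. f z) + (LINT z:{1<..}|lborel. f z)"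
    unfolding un by (rule set_integral_Un[OF _ int01 hi_f(1)]) auto
  also have "(LINT z:{0<..<1} \<union> {1}|lborel. f z) = (LINT z:{0<..<1}|lborel. f z)"
    using pt(2) by (subst set_integral_Un[OF _ lo_f(1) pt(1)]) auto
  also have "(LINT z:{0<..<1}|lborel. f z) + (LINT z:{1<..}|lborel. f z) = 1 / (2 * of_real pi) * ((LINT y|lborel. g (Complex c1 y) * (1 / (\<delta> - Complex c1 y))) +
      (LINT y|lborel. g (Complex c2 y) * (- 1 / (\<delta> - Complex c2 y))))"
    unfolding lo_f(2) hi_f(2) lo(2) hi(2) by (rule distrib_left[symmetric])
  also have "(\<lambda>y. g (Complex c1 y) * (1 / (\<delta> - Complex c1 y))) = (\<lambda>y. - G (Complex c1 y))"
    by (auto simp: G_def) (metis minus_diff_eq minus_divide_right)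
  also have "(\<lambda>y. g (Complex c2 y) * (- 1 / (\<delta> - Complex c2 y))) = (\<lambda>y. G (Complex c2 y))"
    by (auto simp: G_def) (metis minus_diff_eq minus_divide_right)
  finally have LG: "(LINT z:{0<..}|lborel. f z) =
      1 / (2 * of_real pi) * ((LINT y|lborel. G (Complex c2 y)) - (LINT y|lborel. G (Complex c1 y)))"
    by simp
  have holG: "G holomorphic_on St - {\<delta>}"
    unfolding G_def by (intro holomorphic_intros holomorphic_on_subset[OF hol]) auto
  have "\<i> * ((LINT y|lborel. G (Complex c2 y)) - (LINT y|lborel. G (Complex c1 y))) = 2 * of_real pi * \<i> * g \<delta>"
  proof -
    obtain C where C: "\<And>s. c1 \<le> Re s \<Longrightarrow> Re s \<le> c2 \<Longrightarrow> \<bar>Im s\<bar> \<ge> 1 \<Longrightarrow> norm (g s) \<le> C / (1 + (Im s)\<^sup>2)"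
      using decay[of c1 c2] c1 c2 by auto
    show ?thesis
    \<comment> \<open>At heights beyond \<bar>Im \<delta>\<bar> + 1 one has \<bar>s - \<delta>\<bar>
      \<ge> 1, so G inherits the bound of g; the same heights put \<delta> inside the
      rectangle.\<close>
    proof (rule strip_contour_shift[where Y = "\<bar>Im \<delta>\<bar> + 1" and C = C])
      show "c1 < c2" using c1 c2 by simp
      show "continuous_on UNIV (\<lambda>y. G (Complex x y))" if "x \<in> {c1, c2}" for x
        using that c1 c2 by (intro contl[OF holomorphic_on_imp_continuous_on[OF holG]]) (auto simp: St_def)
      show "norm (G s) \<le> C / (1 + (Im s)\<^sup>2)" if s: "c1 \<le> Re s" "Re s \<le> c2" "\<bar>Im \<delta>\<bar> + 1 \<le> \<bar>Im s\<bar>" for s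
      proof -
        have "1 \<le> \<bar>Im (s - \<delta>)\<bar>" using s by auto
        also have "\<dots> \<le> norm (s - \<delta>)" by (rule abs_Im_le_cmod)
        finally have "norm (G s) \<le> norm (g s)"
          by (simp add: G_def norm_divide divide_le_eq mult_le_cancel_left1)
        also have "\<dots> \<le> C / (1 + (Im s)\<^sup>2)" using s by (intro C) auto
        finally show ?thesis .
      qed
      show "(G has_contour_integral 2 * of_real pi * \<i> * g \<delta>) (rectpath (Complex c1 (- T)) (Complex c2 T))"
        if T: "\<bar>Im \<delta>\<bar> + 1 \<le> T" for T
      proof -
        have box: "\<delta> \<in> box (Complex c1 (- T)) (Complex c2 T)"
          using T c1 c2 by (auto simp: in_box_complex_iff)
        have "T \<ge> 0" using T abs_ge_zero[of "Im \<delta>"] by linarith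
        with box have "path_image (rectpath (Complex c1 (- T)) (Complex c2 T)) \<subseteq> St - {\<delta>}"
          using rectsub[of c1 c2 T] path_image_rectpath_inter_box[of "Complex c1 (- T)" "Complex c2 T"] T c1 c2 by auto
        moreover have "winding_number (rectpath (Complex c1 (- T)) (Complex c2 T)) \<delta> = 1"
          by (rule winding_number_rectpath[OF box])
        moreover have "\<delta> \<in> interior St" using \<delta> St by (simp add: interior_open St_def)
        ultimately show ?thesis
          using Cauchy_integral_formula_convex_simple[OF St(2) hol, of \<delta> "rectpath (Complex c1 (- T)) (Complex c2 T)"]
          by (simp add: G_def[abs_def])
      qed
    qed
  qed
  then have "(LINT y|lborel. G (Complex c2 y)) - (LINT y|lborel. G (Complex c1 y)) = 2 * of_real pi * g \<delta>"
    by (metis (no_types, lifting) complex_i_not_zero mult.assoc mult.commute mult_left_cancel)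
  then show ?B unfolding f_def[symmetric] LG by simp
qed

section \<open>Analytic continuation of the kernel\<close>

lemma sin_pi_div_eq_0_iff:
  fixes s :: complex
  assumes "\<alpha> > 0"
  shows "sin (of_real (pi / \<alpha>) * s) = 0 \<longleftrightarrow> (\<exists>n::int. s = of_real (\<alpha> * of_int n))"
proof -
  have "of_real (pi / \<alpha>) * s = of_real (of_int n * pi) \<longleftrightarrow> s = of_real (\<alpha> * of_int n)" for n
    using assms by (simp add: field_simps)
  then show ?thesis by (simp add: Complex_Transcendental.sin_eq_0)
qed

text \<open>A zero has s/\<alpha> = n for an integer n, which is a pole of \<Gamma>(-s/\<alpha>) if
  n \<ge> 0 and of \<Gamma>(1 + s/\<alpha>) if n < 0.\<close>

lemma sin_pi_div_neq_0:
  fixes s :: complex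
  assumes "\<alpha> > 0" "- (s / of_real \<alpha>) \<notin> \<int>\<^sub>\<le>\<^sub>0" "1 + s / of_real \<alpha> \<notin> \<int>\<^sub>\<le>\<^sub>0"
  shows "sin (of_real (pi / \<alpha>) * s) \<noteq> 0"
proof
  assume "sin (of_real (pi / \<alpha>) * s) = 0"
  then obtain n :: int where "s = of_real (\<alpha> * of_int n)" using sin_pi_div_eq_0_iff[OF assms(1)] by blast
  then have n: "s / of_real \<alpha> = of_int n" using assms(1) by simp
  show False
  proof (cases "n \<ge> 0")
    case True
    then have "of_int (- n) \<in> (\<int>\<^sub>\<le>\<^sub>0 :: complex set)" by (intro nonpos_Ints_of_int) auto
    then show False using assms(2) n by simp
  next
    case False
    then have "of_int (1 + n) \<in> (\<int>\<^sub>\<le>\<^sub>0 :: complex set)" by (intro nonpos_Ints_of_int) auto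
    then show False using assms(3) n by simp
  qed
qed

text \<open>The H-function sees the kernel only on a line inside the gap, so any g continuing it
  from there may be used. Agreement is asked only off the zeros of the sine, since at these
  \<open>fox_theta\<close> takes the default value 0 instead of a limit.\<close>

lemma diffusion_mellin:
  assumes \<alpha>: "\<alpha> > 0" and \<beta>: "0 < \<beta>" "\<beta> < 2" and b: "b > 0"
    and hol: "g holomorphic_on {s. - min 1 \<alpha> < Re s \<and> Re s < b}"
    and eq: "\<And>s. Re s < b \<Longrightarrow> sin (of_real (pi / \<alpha>) * s) \<noteq> 0 \<Longrightarrow> g s = diffusion_theta \<alpha> \<beta> s"
    and \<delta>: "- min 1 \<alpha> < Re \<delta>" "Re \<delta> < b"
  shows "set_integrable lborel {0<..} (\<lambda>z. exp ((\<delta> - 1) * of_real (ln z)) *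
           fox_H 2 1 (diffusion_as \<alpha> \<beta>) (diffusion_bs \<alpha>) (of_real z))"
    and "(LINT z:{0<..}|lborel. exp ((\<delta> - 1) * of_real (ln z)) *
           fox_H 2 1 (diffusion_as \<alpha> \<beta>) (diffusion_bs \<alpha>) (of_real z)) = g \<delta>"
proof -
  \<comment> \<open>The midpoint of the gap; the zeros \<alpha>n of the sine avoid it because min 1
    \<alpha> \<le> \<alpha>.\<close>
  define c where "c = - min 1 \<alpha> / 2"
  have c: "- min 1 \<alpha> < c" "c < 0" using \<alpha> by (auto simp: c_def min_def)
  have gc: "g (Complex c y) = diffusion_theta \<alpha> \<beta> (Complex c y)" for y
  proof (rule eq)
    show "Re (Complex c y) < b" using c b by simp
    show "sin (of_real (pi / \<alpha>) * Complex c y) \<noteq> 0"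
    proof
      assume "sin (of_real (pi / \<alpha>) * Complex c y) = 0"
      then obtain n :: int where "Complex c y = of_real (\<alpha> * of_int n)"
        using sin_pi_div_eq_0_iff[OF \<alpha>] by blast
      then have n: "c = \<alpha> * of_int n" by (metis Re_complex_of_real complex.sel(1))
      with c \<alpha> have "n < 0" by (simp add: mult_less_0_iff)
      then have "\<alpha> * of_int n \<le> \<alpha> * (- 1)" using \<alpha> by (intro mult_left_mono) auto
      then show False using n c by (simp add: min_def split: if_splits)
    qed
  qed
  have decay: "\<exists>C. \<forall>s. A \<le> Re s \<and> Re s \<le> B \<and> \<bar>Im s\<bar> \<ge> 1 \<longrightarrow> norm (g s) \<le> C / (1 + (Im s)\<^sup>2)"
    if "B < b" for A B
  proof -
    obtain C where C: "\<And>s. A \<le> Re s \<Longrightarrow> Re s \<le> B \<Longrightarrow> \<bar>Im s\<bar> \<ge> 1 \<Longrightarrow>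
        norm (diffusion_theta \<alpha> \<beta> s) \<le> C / (1 + (Im s)\<^sup>2)"
      using diffusion_theta_decay[OF \<alpha> \<beta>, of A B] by blast
    have "g s = diffusion_theta \<alpha> \<beta> s" if "Re s \<le> B" "\<bar>Im s\<bar> \<ge> 1" for s
      using that \<open>B < b\<close> \<alpha> sin_of_real_mult_neq_0[of "pi / \<alpha>" s] by (intro eq) auto
    then show ?thesis using C by (intro exI[of _ C]) auto
  qed
  have H: "fox_H 2 1 (diffusion_as \<alpha> \<beta>) (diffusion_bs \<alpha>) (of_real z) = 1 / (2 * of_real pi) *
      (LINT y|lborel. g (Complex c y) * exp (- Complex c y * of_real (ln z)))" if "z > 0" for z
    using fox_H_diffusion[OF \<alpha> \<beta> c that] unfolding gc of_real_powr_exp[OF that] .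
  have "c < b" using c b by simp
  note M = mellin_inversion[OF hol decay c(1) this H \<delta>]
  show "set_integrable lborel {0<..} (\<lambda>z. exp ((\<delta> - 1) * of_real (ln z)) *
           fox_H 2 1 (diffusion_as \<alpha> \<beta>) (diffusion_bs \<alpha>) (of_real z))"
    by (rule M(1))
  show "(LINT z:{0<..}|lborel. exp ((\<delta> - 1) * of_real (ln z)) *
           fox_H 2 1 (diffusion_as \<alpha> \<beta>) (diffusion_bs \<alpha>) (of_real z)) = g \<delta>"
    by (rule M(2))
qed

text \<open>The kernel with its removable singularity at \<open>0\<close> filled in, where \<^const>\<open>fox_theta\<close> is \<open>0\<close> by convention.\<close>

definition regular_theta :: "real \<Rightarrow> real \<Rightarrow> complex \<Rightarrow> complex" where
  "regular_theta \<alpha> \<beta> s = of_real \<alpha> / 2 * (Gamma (1 + s) * Gamma (1 + s / of_real \<alpha>) *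
     Gamma (1 - s / of_real \<alpha>) * rGamma (1 - s / 2) * rGamma (1 + s / 2) *
     rGamma (of_real \<beta> + of_real \<beta> * s / of_real \<alpha>))"

text \<open>The functional equation splits -s/\<alpha> off \<Gamma>(1 - s/\<alpha>) and -s/2 off
  1/\<Gamma>(-s/2). Their quotient explains the constant \<alpha>/2 in the definition.\<close>

lemma regular_theta_eq:
  assumes \<alpha>: "\<alpha> > 0" and s: "sin (of_real (pi / \<alpha>) * s) \<noteq> 0"
  shows "regular_theta \<alpha> \<beta> s = diffusion_theta \<alpha> \<beta> s"
proof -
  have s0: "s \<noteq> 0" using s by auto
  have "- (s / of_real \<alpha>) \<notin> \<int>\<^sub>\<le>\<^sub>0"
  proof
    assume "- (s / of_real \<alpha>) \<in> \<int>\<^sub>\<le>\<^sub>0"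
    then obtain n :: nat where "- (s / of_real \<alpha>) = - of_nat n" by (elim nonpos_Ints_cases')
    then have "s = of_real (\<alpha> * of_int (int n))" using \<alpha> by (simp add: field_simps)
    then show False using s sin_pi_div_eq_0_iff[OF \<alpha>] by blast
  qed
  then have 1: "Gamma (1 - s / of_real \<alpha>) = - (s / of_real \<alpha>) * Gamma (- (s / of_real \<alpha>))"
    using Gamma_plus1[of "- (s / of_real \<alpha>)"] by simp
  have 2: "rGamma (- (s / 2)) = - (s / 2) * rGamma (1 - s / 2)"
    using rGamma_plus1[of "- (s / 2)"] by simp
  show ?thesis unfolding regular_theta_def diffusion_theta_eq 1 2 using \<alpha> by simp
qed

lemma regular_theta_holomorphic:
  assumes \<alpha>: "\<alpha> > 0"
  shows "regular_theta \<alpha> \<beta> holomorphic_on {s. - min 1 \<alpha> < Re s \<and> Re s < \<alpha>}"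
proof -
  have pos: "w \<notin> \<int>\<^sub>\<le>\<^sub>0" if "Re w > 0" for w :: complex
    using that by (auto elim!: nonpos_Ints_cases')
  have "1 + s \<notin> \<int>\<^sub>\<le>\<^sub>0" "1 + s / of_real \<alpha> \<notin> \<int>\<^sub>\<le>\<^sub>0" "1 - s / of_real \<alpha> \<notin> \<int>\<^sub>\<le>\<^sub>0"
    if "s \<in> {s. - min 1 \<alpha> < Re s \<and> Re s < \<alpha>}" for s
    using that \<alpha> by (auto intro!: pos simp: min_def field_simps split: if_splits)
  note * = this
  show ?thesis
    unfolding regular_theta_def[abs_def]
    by (intro holomorphic_intros; ((rule *, assumption) | (use assms in simp)))
qed

text \<open>Multiplication by e^(iw) - e^(-iw) makes the sum telescope. The sum is the Chebyshev
  polynomial of the second kind of degree m - 1 at cos w.\<close>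

lemma dirichlet_kernel_mult_sin:
  fixes w :: complex
  shows "(\<Sum>j<m. exp (\<i> * (of_nat m - 1 - 2 * of_nat j) * w)) * sin w = sin (of_nat m * w)"
proof -
  define a where "a j = exp (\<i> * (of_nat m - 2 * of_nat j) * w)" for j
  have "exp (\<i> * (of_nat m - 1 - 2 * of_nat j) * w) * (exp (\<i> * w) - exp (- (\<i> * w))) = a j - a (Suc j)" for j
    unfolding a_def right_diff_distrib exp_add[symmetric] by (simp add: algebra_simps)
  then have "(\<Sum>j<m. exp (\<i> * (of_nat m - 1 - 2 * of_nat j) * w)) * (exp (\<i> * w) - exp (- (\<i> * w))) = (\<Sum>j<m. a j - a (Suc j))"
    by (simp add: sum_distrib_right)
  also have "\<dots> = a 0 - a m" by (rule sum_lessThan_telescope')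
  also have "\<dots> = exp (\<i> * (of_nat m * w)) - exp (- (\<i> * (of_nat m * w)))"
    by (simp add: a_def algebra_simps)
  finally show ?thesis by (simp add: sin_exp_eq mult_ac)
qed

text \<open>For \<open>\<alpha> = 2 m\<close> the quotient of the sines is a Dirichlet kernel, hence entire.\<close>

definition entire_theta :: "nat \<Rightarrow> real \<Rightarrow> complex \<Rightarrow> complex" where
  "entire_theta m \<beta> s = (\<Sum>j<m. exp (\<i> * (of_nat m - 1 - 2 * of_nat j) * (of_real (pi / (2 * real m)) * s))) *
     Gamma (1 + s) * rGamma (of_real \<beta> + of_real \<beta> * s / of_real (2 * real m))"

lemma entire_theta_eq:
  assumes "m > 0" and s: "sin (of_real (pi / (2 * real m)) * s) \<noteq> 0"
  shows "entire_theta m \<beta> s = diffusion_theta (2 * real m) \<beta> s"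
proof -
  have "of_nat m * (of_real (pi / (2 * real m)) * s) = of_real (pi / 2) * s"
    using assms(1) by simp
  then have "(\<Sum>j<m. exp (\<i> * (of_nat m - 1 - 2 * of_nat j) * (of_real (pi / (2 * real m)) * s))) =
      sin (of_real (pi / 2) * s) / sin (of_real (pi / (2 * real m)) * s)"
    using dirichlet_kernel_mult_sin[of m "of_real (pi / (2 * real m)) * s"] s by (simp only: nonzero_eq_divide_eq not_False_eq_True)
  then show ?thesis unfolding entire_theta_def diffusion_theta_sin[OF s] by simp
qed

lemma entire_theta_holomorphic:
  "entire_theta m \<beta> holomorphic_on {s. - min 1 \<alpha> < Re s \<and> Re s < b}"
proof -
  have *: "1 + s \<notin> \<int>\<^sub>\<le>\<^sub>0" if "s \<in> {s. - min 1 \<alpha> < Re s \<and> Re s < b}" for s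
    using that by (auto elim!: nonpos_Ints_cases' simp: add_eq_0_iff2 complex_eq_iff)
  show ?thesis
    unfolding entire_theta_def[abs_def]
    by (cases "m = 0"; intro holomorphic_intros; ((rule *, assumption) | simp))
qed

section \<open>The moments\<close>

text \<open>If the kernel were bounded near \<alpha>, its product with sin(\<pi>s/\<alpha>) would
  tend to 0 there. But the limit of that product is sin(\<pi>\<alpha>/2) \<Gamma>(1 + \<alpha>) /
  \<Gamma>(2\<beta>), which vanishes only for even \<alpha>.\<close>

lemma regular_theta_unbounded:
  assumes \<alpha>: "\<alpha> > 0" and \<beta>: "\<beta> > 0" and not_even: "\<And>m::nat. \<alpha> \<noteq> 2 * real m"
  shows "\<exists>s. \<alpha> / 2 \<le> s \<and> s < \<alpha> \<and> norm (regular_theta \<alpha> \<beta> (of_real s)) > K"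
proof (rule ccontr)
  assume "\<not> ?thesis"
  then have bound: "norm (regular_theta \<alpha> \<beta> (of_real s)) \<le> K" if "\<alpha> / 2 \<le> s" "s < \<alpha>" for s
    using that by force
  define L where "L s = norm (sin (of_real (pi / 2) * of_real s) * Gamma (1 + of_real s) *
      rGamma (of_real \<beta> + of_real \<beta> * of_real s / complex_of_real \<alpha>))" for s :: real
  define R where "R s = K * norm (sin (of_real (pi / \<alpha>) * complex_of_real s))" for s
  have pos: "w \<notin> \<int>\<^sub>\<le>\<^sub>0" if "Re w > 0" for w :: complex
    using that by (auto elim!: nonpos_Ints_cases')
  have "L s \<le> R s" if s: "\<alpha> / 2 \<le> s" "s < \<alpha>" for s
  proof -
    have nz: "sin (of_real (pi / \<alpha>) * complex_of_real s) \<noteq> 0"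
    proof
      assume "sin (of_real (pi / \<alpha>) * complex_of_real s) = 0"
      then obtain n :: int where "complex_of_real s = of_real (\<alpha> * of_int n)"
        using sin_pi_div_eq_0_iff[OF \<alpha>] by blast
      then have n: "s = \<alpha> * of_int n" by (simp only: of_real_eq_iff)
      then have "0 < \<alpha> * of_int n" "\<alpha> * of_int n < \<alpha> * 1" using s \<alpha> by auto
      then have "0 < n" "n < 1" using \<alpha> by (auto simp: zero_less_mult_iff mult_less_cancel_left)
      then show False by linarith
    qed
    have "regular_theta \<alpha> \<beta> (of_real s) * sin (of_real (pi / \<alpha>) * of_real s) =
        sin (of_real (pi / 2) * of_real s) * Gamma (1 + of_real s) * rGamma (of_real \<beta> + of_real \<beta> * of_real s / of_real \<alpha>)"
      unfolding regular_theta_eq[OF \<alpha> nz] diffusion_theta_sin[OF nz] using nz by simp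
    then have "L s = norm (regular_theta \<alpha> \<beta> (of_real s)) * norm (sin (of_real (pi / \<alpha>) * complex_of_real s))"
      unfolding L_def norm_mult[symmetric] by simp
    also have "\<dots> \<le> R s" unfolding R_def using bound[OF s] by (intro mult_right_mono) auto
    finally show ?thesis .
  qed
  then have ev: "eventually (\<lambda>s. L s \<le> R s) (at_left \<alpha>)"
    using \<alpha> by (intro eventually_at_leftI[of "\<alpha> / 2"]) auto
  have "isCont L \<alpha>" unfolding L_def
    using \<alpha> by (intro continuous_intros pos) auto
  then have L: "(L \<longlongrightarrow> L \<alpha>) (at_left \<alpha>)" by (simp add: continuous_at_imp_continuous_at_within continuous_within[symmetric])
  have "isCont R \<alpha>" unfolding R_def by (intro continuous_intros)
  then have R: "(R \<longlongrightarrow> R \<alpha>) (at_left \<alpha>)" by (simp add: continuous_at_imp_continuous_at_within continuous_within[symmetric])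
  have "L \<alpha> \<le> R \<alpha>" by (rule tendsto_le[OF _ R L ev]) simp
  also have "sin (of_real (pi / \<alpha>) * complex_of_real \<alpha>) = 0"
    using sin_pi_div_eq_0_iff[OF \<alpha>, of "of_real \<alpha>"] by (auto intro: exI[of _ 1])
  then have "R \<alpha> = 0" by (simp add: R_def)
  finally have "L \<alpha> = 0" unfolding L_def by simp
  moreover have "sin (of_real (pi / 2) * complex_of_real \<alpha>) \<noteq> 0"
  proof
    assume "sin (of_real (pi / 2) * complex_of_real \<alpha>) = 0"
    then obtain n :: int where "complex_of_real \<alpha> = of_real (2 * of_int n)"
      using sin_pi_div_eq_0_iff[of 2 "of_real \<alpha>"] by auto
    then have n: "\<alpha> = 2 * of_int n" by (simp only: of_real_eq_iff)
    with \<alpha> have "\<alpha> = 2 * real (nat n)" by simp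
    then show False using not_even by blast
  qed
  moreover have "Gamma (1 + complex_of_real \<alpha>) \<noteq> 0"
    using \<alpha> pos[of "1 + of_real \<alpha>"] by (simp add: Gamma_eq_zero_iff)
  moreover have "rGamma (of_real \<beta> + of_real \<beta> * of_real \<alpha> / complex_of_real \<alpha>) \<noteq> 0"
    using \<alpha> \<beta> by (intro rGamma_nonzero pos) auto
  ultimately show False by (simp add: L_def)
qed

text \<open>Integrability at \<delta> and at \<alpha>/2, a point inside the strip, bounds the Mellin
  transform uniformly at all real s in between, contradicting the blow-up at \<alpha>.\<close>

lemma diffusion_mellin_not_integrable:
  assumes \<alpha>: "\<alpha> > 0" and \<beta>: "0 < \<beta>" "\<beta> < 2" and not_even: "\<And>m::nat. \<alpha> \<noteq> 2 * real m"
    and \<delta>: "\<alpha> \<le> Re \<delta>"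
  shows "\<not> set_integrable lborel {0<..} (\<lambda>z. exp ((\<delta> - 1) * of_real (ln z)) *
           fox_H 2 1 (diffusion_as \<alpha> \<beta>) (diffusion_bs \<alpha>) (of_real z))"
proof
  define H where "H z = fox_H 2 1 (diffusion_as \<alpha> \<beta>) (diffusion_bs \<alpha>) (of_real z)" for z
  define f where "f s z = exp ((s - 1) * of_real (ln z)) * H z" for s z
  assume "set_integrable lborel {0<..} (\<lambda>z. exp ((\<delta> - 1) * of_real (ln z)) *
           fox_H 2 1 (diffusion_as \<alpha> \<beta>) (diffusion_bs \<alpha>) (of_real z))"
  then have int: "set_integrable lborel {0<..} (f \<delta>)" unfolding f_def H_def .
  note M = diffusion_mellin[OF \<alpha> \<beta> \<alpha> regular_theta_holomorphic[OF \<alpha>] regular_theta_eq[OF \<alpha>], folded H_def, folded f_def]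
  have int0: "set_integrable lborel {0<..} (f (of_real (\<alpha> / 2)))"
    using \<alpha> by (intro M(1)) (auto simp: min_def)
  define K where "K = (LINT z:{0<..}|lborel. norm (f (of_real (\<alpha> / 2)) z)) + (LINT z:{0<..}|lborel. norm (f \<delta> z))"
  have "norm (regular_theta \<alpha> \<beta> (of_real s)) \<le> K" if s: "\<alpha> / 2 \<le> s" "s < \<alpha>" for s
  proof -
    have s': "- min 1 \<alpha> < Re (complex_of_real s)" "Re (complex_of_real s) < \<alpha>" using s \<alpha> by (auto simp: min_def)
    have "norm (regular_theta \<alpha> \<beta> (of_real s)) = norm (LINT z:{0<..}|lborel. f (of_real s) z)"
      using M(2)[OF _ s'] by simp
    also have "\<dots> \<le> (LINT z:{0<..}|lborel. norm (f (of_real s) z))"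
      using M(1)[OF _ s'] by (intro set_integral_norm_bound) auto
    also have "\<dots> \<le> (LINT z:{0<..}|lborel. norm (f (of_real (\<alpha> / 2)) z) + norm (f \<delta> z))"
    proof (rule set_integral_mono)
      show "set_integrable lborel {0<..} (\<lambda>z. norm (f (of_real s) z))"
        using M(1)[OF _ s'] by (intro set_integrable_norm) auto
      show "set_integrable lborel {0<..} (\<lambda>z. norm (f (of_real (\<alpha> / 2)) z) + norm (f \<delta> z))"
        by (intro set_integral_add(1) set_integrable_norm int int0)
      fix z :: real assume z: "z \<in> {0<..}"
      \<comment> \<open>Here \<alpha>/2 \<le> s < \<alpha> \<le> Re \<delta>: for z \<le> 1 the
        smaller exponent dominates, for z > 1 the larger one.\<close>
      have "exp ((s - 1) * ln z) \<le> exp ((\<alpha> / 2 - 1) * ln z) + exp ((Re \<delta> - 1) * ln z)"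
      proof (cases "z \<le> 1")
        case True
        then have "ln z \<le> 0" using z by simp
        then have "exp ((s - 1) * ln z) \<le> exp ((\<alpha> / 2 - 1) * ln z)"
          using s by (simp add: mult_right_mono_neg)
        then show ?thesis by (simp add: add_increasing2)
      next
        case False
        then have "ln z \<ge> 0" by simp
        then have "exp ((s - 1) * ln z) \<le> exp ((Re \<delta> - 1) * ln z)"
          using s \<delta> by (simp add: mult_right_mono)
        then show ?thesis by (simp add: add_increasing)
      qed
      then have "exp ((s - 1) * ln z) * norm (H z) \<le> (exp ((\<alpha> / 2 - 1) * ln z) + exp ((Re \<delta> - 1) * ln z)) * norm (H z)"
        by (intro mult_right_mono) auto
      then show "norm (f (of_real s) z) \<le> norm (f (of_real (\<alpha> / 2)) z) + norm (f \<delta> z)"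
        by (simp add: f_def norm_mult distrib_right)
    qed
    also have "\<dots> = K" unfolding K_def
      by (intro set_integral_add(2) set_integrable_norm int int0)
    finally show ?thesis .
  qed
  then show False using regular_theta_unbounded[OF \<alpha> \<beta>(1) not_even, of K] by (metis not_less)
qed

text \<open>The factor 1/\<bar>x\<bar> of the density lowers the exponent to \<delta> - 1, which
  turns the moment into a Mellin integral in z = x/\<kappa>.\<close>

lemma moment_integrand_scaling:
  fixes \<alpha> \<beta> \<eta> t :: real and \<delta> :: complex
  defines "\<kappa> \<equiv> (\<eta> * t powr \<beta>) powr (1 / \<alpha>)"
  assumes pos: "\<alpha> > 0" "\<eta> > 0" "t > 0" and x: "x > 0"
  shows "moment_integrand \<alpha> \<beta> \<eta> \<delta> t x =
    of_real (t powr (\<beta> - 1) / \<alpha>) * exp ((\<delta> - 1) * of_real (ln \<kappa>)) *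
      (exp ((\<delta> - 1) * of_real (ln (x / \<kappa>))) * fox_H 2 1 (diffusion_as \<alpha> \<beta>) (diffusion_bs \<alpha>) (of_real (x / \<kappa>)))"
proof -
  have \<kappa>: "\<kappa> > 0" unfolding \<kappa>_def using pos by simp
  have "exp ((\<delta> - 1) * of_real (ln \<kappa>)) * exp ((\<delta> - 1) * of_real (ln (x / \<kappa>))) = exp ((\<delta> - 1) * of_real (ln x))"
    unfolding exp_add[symmetric] distrib_left[symmetric] of_real_add[symmetric] using \<kappa> x by (simp add: ln_div)
  also have "\<dots> = of_real x powr \<delta> / of_real x"
    unfolding of_real_powr_exp[OF x] using x
    by (simp add: left_diff_distrib exp_diff exp_of_real flip: of_real_exp)
  finally have e: "exp ((\<delta> - 1) * of_real (ln \<kappa>)) * exp ((\<delta> - 1) * of_real (ln (x / \<kappa>))) = of_real x powr \<delta> / of_real x" .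
  have "moment_integrand \<alpha> \<beta> \<eta> \<delta> t x = of_real (t powr (\<beta> - 1) / \<alpha>) * (of_real x powr \<delta> / of_real x) *
      fox_H 2 1 (diffusion_as \<alpha> \<beta>) (diffusion_bs \<alpha>) (of_real (x / \<kappa>))"
    using x by (simp add: moment_integrand_def diffusion_N_def \<kappa>_def)
  then show ?thesis unfolding e[symmetric] by (simp only: mult.assoc)
qed

text \<open>Evenness supplies the factor 2, and the Jacobian \<kappa> of the substitution raises
  \<kappa>^(\<delta> - 1) to \<kappa>^\<delta>. The equivalence transfers integrability in both
  directions, so that failure of the Mellin integral also rules out the moment.\<close>

lemma moment_integrand_integrable_iff:
  fixes \<alpha> \<beta> \<eta> t :: real and \<delta> :: complex
  defines "\<kappa> \<equiv> (\<eta> * t powr \<beta>) powr (1 / \<alpha>)"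
    and "f \<equiv> \<lambda>z. exp ((\<delta> - 1) * of_real (ln z)) * fox_H 2 1 (diffusion_as \<alpha> \<beta>) (diffusion_bs \<alpha>) (of_real z)"
  assumes pos: "\<alpha> > 0" "\<eta> > 0" "t > 0"
  shows "integrable lborel (moment_integrand \<alpha> \<beta> \<eta> \<delta> t) \<longleftrightarrow> set_integrable lborel {0<..} f"
    and "set_integrable lborel {0<..} f \<Longrightarrow> fractional_moment \<alpha> \<beta> \<eta> \<delta> t =
      2 * of_real (t powr (\<beta> - 1) / \<alpha>) * exp (\<delta> * of_real (ln \<kappa>)) * (LINT z:{0<..}|lborel. f z)"
proof -
  define m where "m = moment_integrand \<alpha> \<beta> \<eta> \<delta> t"
  define C where "C = of_real (t powr (\<beta> - 1) / \<alpha>) * exp ((\<delta> - 1) * of_real (ln \<kappa>))"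
  define F where "F z = indicat_real {0<..} z *\<^sub>R f z" for z
  have \<kappa>: "\<kappa> > 0" unfolding \<kappa>_def using pos by simp
  have C: "C \<noteq> 0" using pos by (simp add: C_def)
  have half: "indicat_real {0..} x *\<^sub>R m x = C * F (0 + 1 / \<kappa> * x)" for x
  proof (cases "x > 0")
    case True
    then show ?thesis
      using moment_integrand_scaling[OF pos True, of \<beta> \<delta>] \<kappa>
      by (simp add: m_def F_def f_def C_def \<kappa>_def)
  next
    case False
    \<comment> \<open>The rule for even functions uses the closed half-line, F the open one. They
      agree at 0 because \<open>0 powr \<delta>\<close> is 0.\<close>
    moreover have "m 0 = 0" by (simp add: m_def moment_integrand_def)
    ultimately show ?thesis using \<kappa> by (cases "x = 0") (auto simp: F_def indicator_def zero_less_divide_iff)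
  qed
  have F_iff: "integrable lborel (\<lambda>x. F (0 + 1 / \<kappa> * x)) \<longleftrightarrow> integrable lborel F"
    using \<kappa> by (intro lborel_integrable_real_affine_iff) auto
  have val: "has_bochner_integral lborel m (2 *\<^sub>R (C * (\<kappa> *\<^sub>R (LINT z|lborel. F z))))" if "integrable lborel F"
  proof (rule has_bochner_integral_even_function)
    have "has_bochner_integral lborel F (LINT z|lborel. F z)"
      using that by (rule has_bochner_integral_integrable)
    then have "has_bochner_integral lborel (\<lambda>x. F (0 + 1 / \<kappa> * x)) ((LINT z|lborel. F z) /\<^sub>R \<bar>1 / \<kappa>\<bar>)"
      using \<kappa> by (subst (asm) lborel_has_bochner_integral_real_affine_iff[of "1 / \<kappa>" _ _ 0]) auto
    then have "has_bochner_integral lborel (\<lambda>x. C * F (0 + 1 / \<kappa> * x)) (C * ((LINT z|lborel. F z) /\<^sub>R \<bar>1 / \<kappa>\<bar>))"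
      by (rule has_bochner_integral_mult_right)
    then show "has_bochner_integral lborel (\<lambda>x. indicat_real {0..} x *\<^sub>R m x) (C * (\<kappa> *\<^sub>R (LINT z|lborel. F z)))"
      unfolding half using \<kappa> by simp
    show "m (- x) = m x" for x by (simp add: m_def moment_integrand_def diffusion_N_def)
  qed
  have "integrable lborel F" if "integrable lborel m"
  proof -
    have "integrable lborel (\<lambda>x. indicat_real {0..} x *\<^sub>R m x)"
      using that by (intro integrable_mult_indicator) auto
    then have "integrable lborel (\<lambda>x. inverse C * (C * F (0 + 1 / \<kappa> * x)))"
      unfolding half by (rule integrable_mult_right)
    then show ?thesis using C F_iff by (simp flip: mult.assoc)
  qed
  then have "integrable lborel m \<longleftrightarrow> integrable lborel F"
    using val by (blast intro: integrable.intros)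
  then show "integrable lborel (moment_integrand \<alpha> \<beta> \<eta> \<delta> t) \<longleftrightarrow> set_integrable lborel {0<..} f"
    by (simp only: m_def set_integrable_def F_def[abs_def])
  assume "set_integrable lborel {0<..} f"
  then have "integrable lborel F" by (simp add: set_integrable_def F_def[abs_def])
  then have "fractional_moment \<alpha> \<beta> \<eta> \<delta> t = 2 *\<^sub>R (C * (\<kappa> *\<^sub>R (LINT z|lborel. F z)))"
    unfolding fractional_moment_def m_def[symmetric] by (intro has_bochner_integral_integral_eq val)
  also have "\<dots> = 2 * (C * of_real \<kappa>) * (LINT z|lborel. F z)" by (simp add: scaleR_conv_of_real)
  also have "C * of_real \<kappa> = of_real (t powr (\<beta> - 1) / \<alpha>) * exp (\<delta> * of_real (ln \<kappa>))"
  proof -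
    have "complex_of_real \<kappa> = exp (of_real (ln \<kappa>))" using \<kappa> by (simp add: exp_of_real)
    then show ?thesis unfolding C_def by (simp add: left_diff_distrib exp_diff)
  qed
  finally show "fractional_moment \<alpha> \<beta> \<eta> \<delta> t =
      2 * of_real (t powr (\<beta> - 1) / \<alpha>) * exp (\<delta> * of_real (ln \<kappa>)) * (LINT z:{0<..}|lborel. f z)"
    by (simp add: set_lebesgue_integral_def F_def mult.assoc)
qed

text \<open>The Lebesgue integral is 0 by convention when the integrand is not integrable, so the
  formula is asserted under integrability, and integrability itself is established for Re \<delta> <
  \<alpha>. The exclusions of nonpositive integers express that the six gamma values exist.\<close>

theorem mainTheorem4:
  fixes \<alpha> \<beta> \<eta> t :: real and \<delta> :: complex
  assumes "0 < \<beta>" and "\<beta> \<le> 1" and "\<alpha> > 0" and "\<eta> > 0" and "t > 0"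
    and "Re \<delta> > -1" and "Re (\<delta> + of_real \<alpha>) > 0"
    and "- (\<delta> / of_real \<alpha>) \<notin> \<int>\<^sub>\<le>\<^sub>0" and "1 + \<delta> \<notin> \<int>\<^sub>\<le>\<^sub>0" and "1 + \<delta> / of_real \<alpha> \<notin> \<int>\<^sub>\<le>\<^sub>0"
    and "- (\<delta> / 2) \<notin> \<int>\<^sub>\<le>\<^sub>0" and "of_real \<beta> + of_real \<beta> * \<delta> / of_real \<alpha> \<notin> \<int>\<^sub>\<le>\<^sub>0"
    and "1 + \<delta> / 2 \<notin> \<int>\<^sub>\<le>\<^sub>0"
  shows "(integrable lborel (moment_integrand \<alpha> \<beta> \<eta> \<delta> t) \<longrightarrow>
           fractional_moment \<alpha> \<beta> \<eta> \<delta> t =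
             2 / of_real \<alpha> * of_real \<eta> powr (\<delta> / of_real \<alpha>) *
             of_real t powr (of_real \<beta> * (\<delta> / of_real \<alpha> + 1 - 1 / of_real \<beta>)) *
             ((Gamma (- (\<delta> / of_real \<alpha>)) * Gamma (1 + \<delta>) * Gamma (1 + \<delta> / of_real \<alpha>)) /
              (Gamma (- (\<delta> / 2)) * Gamma (of_real \<beta> + of_real \<beta> * \<delta> / of_real \<alpha>) *
               Gamma (1 + \<delta> / 2)))) \<and>
         (Re \<delta> < \<alpha> \<longrightarrow> integrable lborel (moment_integrand \<alpha> \<beta> \<eta> \<delta> t))"
proof -
  define f where "f z = exp ((\<delta> - 1) * of_real (ln z)) *
    fox_H 2 1 (diffusion_as \<alpha> \<beta>) (diffusion_bs \<alpha>) (of_real z)" for z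
  define \<kappa> where "\<kappa> = (\<eta> * t powr \<beta>) powr (1 / \<alpha>)"
  note \<alpha> = \<open>\<alpha> > 0\<close>
  have \<beta>: "0 < \<beta>" "\<beta> < 2" using assms by auto
  note red = moment_integrand_integrable_iff[OF \<open>\<alpha> > 0\<close> \<open>\<eta> > 0\<close> \<open>t > 0\<close>, where \<beta> = \<beta> and \<delta> = \<delta>, folded f_def, folded \<kappa>_def]
  have lo: "- min 1 \<alpha> < Re \<delta>" using assms by (auto simp: min_def)
  have nz: "sin (of_real (pi / \<alpha>) * \<delta>) \<noteq> 0" by (rule sin_pi_div_neq_0[OF \<alpha> assms(8,10)])
  have strip: "set_integrable lborel {0<..} f \<and> (LINT z:{0<..}|lborel. f z) = diffusion_theta \<alpha> \<beta> \<delta>"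
    if "Re \<delta> < \<alpha>"
    using diffusion_mellin[OF \<alpha> \<beta> \<alpha> regular_theta_holomorphic[OF \<alpha>] regular_theta_eq[OF \<alpha>] lo that, folded f_def]
    unfolding regular_theta_eq[OF \<alpha> nz] by blast
  have int: "(LINT z:{0<..}|lborel. f z) = diffusion_theta \<alpha> \<beta> \<delta>" if f: "set_integrable lborel {0<..} f"
  proof (cases "Re \<delta> < \<alpha>")
    case True
    then show ?thesis using strip by blast
  next
    case False
    \<comment> \<open>Integrability with Re \<delta> \<ge> \<alpha> contradicts the blow-up at
      \<alpha> unless \<alpha> is an even integer.\<close>
    then obtain m :: nat where m: "\<alpha> = 2 * real m"
      using diffusion_mellin_not_integrable[OF \<alpha> \<beta>, of \<delta>] f unfolding f_def by fastforce
    then have "m > 0" using \<alpha> by simp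
    have "(LINT z:{0<..}|lborel. f z) = entire_theta m \<beta> \<delta>"
      unfolding f_def
    \<comment> \<open>The continuation for even \<alpha> has no poles to the right, so any bound
      beyond Re \<delta> would do; Re \<delta> + 1 is also positive since Re \<delta> > -1.\<close>
    proof (rule diffusion_mellin(2)[OF \<alpha> \<beta> _ entire_theta_holomorphic _ lo])
      show "entire_theta m \<beta> s = diffusion_theta \<alpha> \<beta> s" if "sin (of_real (pi / \<alpha>) * s) \<noteq> 0" for s
        unfolding m using that \<open>m > 0\<close> by (intro entire_theta_eq) (simp_all add: m)
      show "Re \<delta> < Re \<delta> + 1" by simp
      show "0 < Re \<delta> + 1" using assms by simp
    qed
    also have "\<dots> = diffusion_theta \<alpha> \<beta> \<delta>"
      unfolding m using nz \<open>m > 0\<close> by (intro entire_theta_eq) (simp_all add: m)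
    finally show ?thesis .
  qed
  have theta: "diffusion_theta \<alpha> \<beta> \<delta> =
      (Gamma (- (\<delta> / of_real \<alpha>)) * Gamma (1 + \<delta>) * Gamma (1 + \<delta> / of_real \<alpha>)) /
      (Gamma (- (\<delta> / 2)) * Gamma (of_real \<beta> + of_real \<beta> * \<delta> / of_real \<alpha>) * Gamma (1 + \<delta> / 2))"
    unfolding diffusion_theta_eq
    by (simp only: rGamma_inverse_Gamma divide_inverse inverse_mult_distrib mult_ac)
  \<comment> \<open>\<kappa>^\<delta> equals \<eta>^(\<delta>/\<alpha>)
    t^(\<beta>\<delta>/\<alpha>); together with t^(\<beta> - 1) from the density this gives the
    stated power of t.\<close>
  have pref: "2 * of_real (t powr (\<beta> - 1) / \<alpha>) * exp (\<delta> * of_real (ln \<kappa>)) =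
      2 / of_real \<alpha> * of_real \<eta> powr (\<delta> / of_real \<alpha>) *
             of_real t powr (of_real \<beta> * (\<delta> / of_real \<alpha> + 1 - 1 / of_real \<beta>))"
  proof -
    have "ln \<kappa> = (ln \<eta> + \<beta> * ln t) / \<alpha>"
      using assms by (simp add: \<kappa>_def ln_powr ln_mult)
    then have "complex_of_real (ln \<kappa>) = (of_real (ln \<eta>) + of_real \<beta> * of_real (ln t)) / of_real \<alpha>"
      by simp
    then have "\<delta> * of_real (ln \<kappa>) = \<delta> / of_real \<alpha> * of_real (ln \<eta>) + of_real \<beta> * (\<delta> / of_real \<alpha>) * of_real (ln t)"
      by (simp add: add_divide_distrib distrib_left)
    moreover have "complex_of_real (t powr (\<beta> - 1)) = exp ((of_real \<beta> - 1) * of_real (ln t))"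
      using assms by (simp add: powr_def exp_of_real[symmetric])
    moreover have "of_real \<beta> * (\<delta> / of_real \<alpha> + 1 - 1 / of_real \<beta>) = of_real \<beta> * (\<delta> / of_real \<alpha>) + (of_real \<beta> - 1)"
      using \<beta> by (simp add: algebra_simps)
    ultimately show ?thesis
      using assms by (simp add: of_real_powr_exp distrib_right exp_add)
  qed
  show ?thesis
  proof (intro conjI impI)
    assume "integrable lborel (moment_integrand \<alpha> \<beta> \<eta> \<delta> t)"
    then have f: "set_integrable lborel {0<..} f" by (simp only: red(1))
    show "fractional_moment \<alpha> \<beta> \<eta> \<delta> t =
             2 / of_real \<alpha> * of_real \<eta> powr (\<delta> / of_real \<alpha>) *
             of_real t powr (of_real \<beta> * (\<delta> / of_real \<alpha> + 1 - 1 / of_real \<beta>)) *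
             ((Gamma (- (\<delta> / of_real \<alpha>)) * Gamma (1 + \<delta>) * Gamma (1 + \<delta> / of_real \<alpha>)) /
              (Gamma (- (\<delta> / 2)) * Gamma (of_real \<beta> + of_real \<beta> * \<delta> / of_real \<alpha>) *
               Gamma (1 + \<delta> / 2)))"
      unfolding red(2)[OF f] int[OF f] pref theta ..
  next
    assume "Re \<delta> < \<alpha>"
    then show "integrable lborel (moment_integrand \<alpha> \<beta> \<eta> \<delta> t)"
      using strip by (simp only: red(1))
  qed
qed

end
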